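(* For every integer $m\ge 3$ there exists $\delta=\delta(m)>0$ with the following property: if $f(z)=z^{m}+\sum_{k=0}^{m-1}a_{k}z^{k}$ (with $a_k\in\mathbb{C}$) satisfies $|a_{k}|<\delta$ for all $1\le k\le m-1$ (no condition on $a_0$) and $\Omega(f)$ is simply connected, then the Brennan conjecture holds for $\Omega(f)$.
   Context: For a polynomial $f$ of degree $\ge 2$, $\Omega(f)=\{z\in\hat{\mathbb{C}}: f^{n}(z)\to\infty \text{ as } n\to+\infty\}$, where $f^n$ is the $n$-th iterate. We say the Brennan conjecture holds for a simply connected domain $\Omega\subsetneq\hat{\mathbb{C}}$ if for a (equivalently any) biholomorphic map $F:\Omega\to\mathbb{D}$ onto the unit disk and every $p\in(\tfrac43,4)$, one has $\int_{\Omega\cap\mathbb{C}}|F'(z)|^{p}\,dA(z)<+\infty$, where $dA$ is Lebesgue area measure. *)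

theory Defs
  imports "HOL-Complex_Analysis.Complex_Analysis"
begin

definition monic_poly :: "nat \<Rightarrow> (nat \<Rightarrow> complex) \<Rightarrow> complex \<Rightarrow> complex" where
  "monic_poly m a z = z ^ m + (\<Sum>k<m. a k * z ^ k)"

definition basin_fin :: "(complex \<Rightarrow> complex) \<Rightarrow> complex set" where
  "basin_fin f = {z. filterlim (\<lambda>n. (f ^^ n) z) at_infinity sequentially}"

text \<open>The Riemann sphere realised as the unit sphere in R^3 via inverse stereographic
  projection; infinity corresponds to the north pole.\<close>
definition stereo :: "complex \<Rightarrow> real \<times> real \<times> real" where
  "stereo z = (2 * Re z / (cmod z ^ 2 + 1), 2 * Im z / (cmod z ^ 2 + 1),
               (cmod z ^ 2 - 1) / (cmod z ^ 2 + 1))"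

definition north_pole :: "real \<times> real \<times> real" where
  "north_pole = (0, 0, 1)"

definition basin_sphere :: "(complex \<Rightarrow> complex) \<Rightarrow> (real \<times> real \<times> real) set" where
  "basin_sphere f = insert north_pole (stereo ` basin_fin f)"

text \<open>F is a biholomorphic map from Omega = A \<union> {\<infinity>} (A \<subseteq> C the finite part) onto
  the unit disk, with value c at infinity: F is holomorphic and injective on A, maps A
  onto the disk minus c, and in the chart w = 1/z at infinity the map
  (w \<mapsto> F(1/w), 0 \<mapsto> c) is holomorphic near 0.\<close>
definition biholo_to_disk :: "complex set \<Rightarrow> (complex \<Rightarrow> complex) \<Rightarrow> complex \<Rightarrow> bool" where
  "biholo_to_disk A F c \<longleftrightarrow>
     F holomorphic_on A \<and> inj_on F A \<and> c \<in> ball 0 1 \<and> c \<notin> F ` A \<and>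
     F ` A = ball 0 1 - {c} \<and>
     (\<exists>r>0. ball 0 r - {0} \<subseteq> (\<lambda>z. 1 / z) ` A \<and>
            (\<lambda>w. if w = 0 then c else F (1 / w)) holomorphic_on ball 0 r)"

text \<open>Brennan conjecture for the simply connected domain Omega = A \<union> {\<infinity>}, with
  the integral over the finite part A of |F'|^p w.r.t. Lebesgue area measure.\<close>
definition brennan_holds :: "complex set \<Rightarrow> bool" where
  "brennan_holds A \<longleftrightarrow>
     (\<forall>F c. biholo_to_disk A F c \<longrightarrow>
        (\<forall>p::real. 4/3 < p \<and> p < 4 \<longrightarrow>
           (\<integral>\<^sup>+ z \<in> A. ennreal (cmod (deriv F z) powr p) \<partial>lborel) < \<infinity>))"

end

theory Submission
  imports Defs "HOL-Computational_Algebra.Fundamental_Theorem_Algebra"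
begin

text \<open>
  Let \<open>A\<close> be the finite part of the basin and \<open>G\<close> its Riemann map, normalised by \<open>G \<infinity> = 0\<close>.
  By the maximum principle on the disk, \<open>G \<circ> f = \<kappa> G ^ m\<close> with \<open>|\<kappa>| = 1\<close>. Hence \<open>f\<close> has no critical
  point in \<open>A\<close>; as one critical point is close to 0, its image, close to \<open>a 0\<close>, does not escape, and
  this bounds \<open>a 0\<close> by a number \<open>R\<close> with \<open>R ^ (m - 1)\<close> slightly larger than 2, which is also an escape
  radius.

  On the set of points leaving the disk of radius \<open>R\<close> at time \<open>n + 1\<close> the functional equation gives
  \<open>|G'| \<le> C m ^ (-n) |(f ^^ n)'|\<close>. By change of variables, integrating \<open>|(f ^^ n)'| ^ 4\<close> over
  this set amounts to iterating the transfer operator \<open>g \<mapsto> (x \<mapsto> \<Sum> |f' y|\<^sup>2 g y)\<close>, the sum being over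
  \<open>f y = x\<close>. For \<open>g x = |x - a 0|\<^sup>2 + 2\<close> this operator multiplies \<open>g\<close> by at most
  \<open>m\<^sup>3 (m - 1/20) < m ^ 4\<close>, so \<open>|G'| ^ 4\<close> is integrable over the bounded part of \<open>A\<close>. Near
  infinity \<open>|F'|\<close> decays like \<open>|z| ^ (-2)\<close>.
\<close>

section \<open>Change of variables for non-injective holomorphic maps\<close>

text \<open>Exponent 4 itself is reached, and this is where \<open>m \<ge> 3\<close> matters: for
  \<open>z^2 - 2\<close> the complement of the basin is the segment from -2 to 2, near whose ends
  \<open>|G'|\<close> grows like the inverse square root of the distance, so \<open>|G'| ^ 4\<close>
  is not integrable there.

  Of the four factors \<open>|f' y|\<close> produced by one step of the iteration, two are spent as
  the Jacobian of \<open>y \<mapsto> f y\<close> and two remain in the fibre sum; this is the origin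
  of the square in the transfer operator. The rate \<open>m ^ 4\<close> is the break-even point
  because the factor \<open>m ^ (-n)\<close> in the bound for \<open>|G'|\<close> is also raised to
  the fourth power.

  The number 2 comes from \<open>|w ^ m + a 0| \<ge> R * (R ^ (m-1) - 1)\<close> for
  \<open>|w| = R \<ge> |a 0|\<close>: moduli start to grow once \<open>R ^ (m-1) > 2\<close>. One
  radius thus serves three purposes: it bounds \<open>a 0\<close>, it bounds the points that have
  not yet escaped, and it bounds the fibres over them.\<close>

definition c2v :: "complex \<Rightarrow> real^2" where
  "c2v z = (\<chi> i. if i = 1 then Re z else Im z)"

definition v2c :: "real^2 \<Rightarrow> complex" where
  "v2c v = Complex (v $ 1) (v $ 2)"

lemma v2c_c2v [simp]: "v2c (c2v z) = z"
  by (simp add: v2c_def c2v_def)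

lemma c2v_v2c [simp]: "c2v (v2c v) = v"
  by (simp add: v2c_def c2v_def vec_eq_iff forall_2)

lemma bounded_linear_c2v: "bounded_linear c2v"
  by (intro linear_conv_bounded_linear[THEN iffD1] linearI)
     (auto simp: c2v_def vec_eq_iff)

lemma bounded_linear_v2c: "bounded_linear v2c"
  by (intro linear_conv_bounded_linear[THEN iffD1] linearI)
     (auto simp: v2c_def complex_eq_iff)

lemma v2c_measurable [measurable]: "v2c \<in> borel \<rightarrow>\<^sub>M borel"
  by (intro borel_measurable_continuous_onI linear_continuous_on bounded_linear_v2c)

lemma c2v_image_eq_vimage: "c2v ` E = v2c -` E"
  using image_iff by fastforce

lemma c2v_image_measurable: "E \<in> sets borel \<Longrightarrow> c2v ` E \<in> sets borel"
  using measurable_sets[OF v2c_measurable, of E] by (simp add: c2v_image_eq_vimage)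

text \<open>Lebesgue measure is determined by its values on boxes, and \<open>v2c\<close> pulls a
  box back to a box with the same side lengths. This carries measures and integrals over to
  \<open>real^2\<close>, where the Jacobian theorem is available.\<close>

lemma lborel_eq_distr_v2c: "lborel = distr lborel borel v2c"
proof (rule lborel_eqI)
  fix l u :: complex
  assume le: "\<And>b. b \<in> Basis \<Longrightarrow> l \<bullet> b \<le> u \<bullet> b"
  have eq: "v2c -` box l u = box (c2v l) (c2v u)"
    by (auto simp: box_def c2v_def v2c_def Basis_complex_def Basis_vec_def inner_axis forall_2)
  have le': "c2v l \<bullet> b \<le> c2v u \<bullet> b" if "b \<in> Basis" for b
    using le[of 1] le[of \<i>] that by (auto simp: c2v_def Basis_complex_def Basis_vec_def inner_axis forall_2)
  have "emeasure (distr lborel borel v2c) (box l u) = emeasure lborel (box (c2v l) (c2v u))"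
    by (subst emeasure_distr) (auto simp: eq)
  also have "\<dots> = (\<Prod>b\<in>Basis. (c2v u - c2v l) \<bullet> b)"
    using le' by (intro emeasure_lborel_box)
  also have "(\<Prod>b\<in>Basis. (c2v u - c2v l) \<bullet> b) = (\<Prod>b\<in>Basis. (u - l) \<bullet> b)"
  proof -
    have B: "(Basis::(real^2) set) = {axis 1 1, axis 2 1}"
      by (auto simp: Basis_vec_def) (metis exhaust_2)
    have "axis (1::2) (1::real) \<noteq> axis 2 1" by (simp add: axis_eq_axis)
    then show ?thesis by (simp add: B Basis_complex_def inner_axis c2v_def)
  qed
  finally show "emeasure (distr lborel borel v2c) (box l u) = (\<Prod>b\<in>Basis. (u - l) \<bullet> b)" .
qed simp

lemma nn_integral_v2c:
  assumes [measurable]: "\<phi> \<in> borel_measurable borel"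
  shows "(\<integral>\<^sup>+ v. \<phi> (v2c v) \<partial>lborel) = (\<integral>\<^sup>+ z. \<phi> z \<partial>lborel)"
proof -
  have "(\<integral>\<^sup>+ z. \<phi> z \<partial>lborel) = (\<integral>\<^sup>+ z. \<phi> z \<partial>distr lborel borel v2c)"
    using lborel_eq_distr_v2c by simp
  then show ?thesis by (simp add: nn_integral_distr)
qed

lemma emeasure_lborel_c2v_image:
  assumes "E \<in> sets borel"
  shows "emeasure lborel (c2v ` E) = emeasure lborel E"
proof -
  have "emeasure lborel E = emeasure (distr lborel borel v2c) E"
    using lborel_eq_distr_v2c by simp
  also have "\<dots> = emeasure lborel (v2c -` E)"
    using assms by (subst emeasure_distr) auto
  finally show ?thesis by (simp add: c2v_image_eq_vimage)
qed

lemma det_matrix_complex_mult: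
  "det (matrix (\<lambda>v. c2v (a * v2c v))) = (cmod a)\<^sup>2"
  by (simp add: det_2 matrix_def c2v_def v2c_def axis_def cmod_power2 flip: power2_eq_square)

text \<open>The real derivative of \<open>f\<close> is multiplication by \<open>deriv f z\<close>,
  with determinant \<open>|deriv f z|^2\<close>. The bound \<open>C\<close> and the finite measure
  of \<open>E\<close> make the Jacobian integral a real number \<open>r\<close>, as the passage to
  \<open>has_integral\<close> requires.\<close>

lemma emeasure_injective_holomorphic_image:
  assumes holf: "f holomorphic_on U" and "open U" and inj: "inj_on f U"
    and EU: "E \<subseteq> U" and E: "E \<in> sets borel" and fE: "f ` E \<in> sets borel"
    and C: "\<And>z. z \<in> E \<Longrightarrow> cmod (deriv f z) \<le> C" and fin: "emeasure lborel E < \<infinity>"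
  shows "emeasure lborel (f ` E) = (\<integral>\<^sup>+ z. indicator E z * ennreal ((cmod (deriv f z))\<^sup>2) \<partial>lborel)"
proof -
  define J where "J z = indicator U z * (cmod (deriv f z))\<^sup>2" for z
  have [measurable]: "E \<in> sets borel" "U \<in> sets borel" using E \<open>open U\<close> by auto
  have J_nonneg: "J z \<ge> 0" for z by (simp add: J_def)
  have "continuous_on U (\<lambda>z. (cmod (deriv f z))\<^sup>2)"
    using holf \<open>open U\<close> by (intro continuous_intros holomorphic_on_imp_continuous_on holomorphic_deriv)
  then have J_meas [measurable]: "J \<in> borel_measurable borel"
    unfolding J_def
    using borel_measurable_continuous_on_indicator[of U "\<lambda>z. (cmod (deriv f z))\<^sup>2"] by simp
  define I where "I = (\<integral>\<^sup>+ z. ennreal (indicator E z * J z) \<partial>lborel)"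
  have I_eq: "(\<integral>\<^sup>+ z. indicator E z * ennreal ((cmod (deriv f z))\<^sup>2) \<partial>lborel) = I"
    unfolding I_def by (rule nn_integral_cong) (use EU in \<open>auto simp: J_def indicator_def\<close>)
  have "I \<le> (\<integral>\<^sup>+ z. ennreal (C\<^sup>2) * indicator E z \<partial>lborel)"
    unfolding I_def
  proof (rule nn_integral_mono)
    fix z show "ennreal (indicator E z * J z) \<le> ennreal (C\<^sup>2) * indicator E z"
      using C[of z] by (auto simp: J_def indicator_def intro!: ennreal_leI power_mono)
  qed
  also have "\<dots> < \<infinity>"
    using fin by (simp add: nn_integral_cmult ennreal_mult_less_top)
  finally obtain r where r: "I = ennreal r" "r \<ge> 0"
    by (cases I) auto
  let ?g = "\<lambda>v. c2v (f (v2c v))"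
  let ?g' = "\<lambda>v w. c2v (deriv f (v2c v) * v2c w)"
  have der: "(?g has_derivative ?g' v) (at v within c2v ` E)" if v: "v \<in> c2v ` E" for v
  proof -
    have "v2c v \<in> U" using v EU by auto
    then have "(f has_field_derivative deriv f (v2c v)) (at (v2c v))"
      using holf \<open>open U\<close> holomorphic_derivI by blast
    then have 1: "(f has_derivative (*) (deriv f (v2c v))) (at (v2c v))"
      by (simp add: has_field_derivative_def)
    have 2: "(v2c has_derivative v2c) (at v within c2v ` E)"
      by (rule bounded_linear_imp_has_derivative[OF bounded_linear_v2c])
    have 3: "(c2v has_derivative c2v) (at (f (v2c v)))"
      by (rule bounded_linear_imp_has_derivative[OF bounded_linear_c2v])
    show ?thesis
      using has_derivative_compose[OF has_derivative_compose[OF 2 1] 3] .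
  qed
  have injg: "inj_on ?g (c2v ` E)"
    using inj EU by (auto simp: inj_on_def) (metis v2c_c2v subsetD)
  have cE: "c2v ` E \<in> sets borel"
    using E by (rule c2v_image_measurable)
  have "(\<integral>\<^sup>+ v. ennreal (indicator E (v2c v) * J (v2c v)) \<partial>lborel) = ennreal r"
    using nn_integral_v2c[of "\<lambda>z. ennreal (indicator E z * J z)"] r by (simp add: I_def)
  then have "((\<lambda>v. indicator E (v2c v) * J (v2c v)) has_integral r) UNIV"
    by (intro nn_integral_has_integral) (use r J_nonneg in auto)
  moreover have "(\<lambda>v. indicator E (v2c v) * J (v2c v)) = 
      (\<lambda>v. if v \<in> c2v ` E then \<bar>det (matrix (?g' v))\<bar> else 0)"
    using EU by (auto simp: fun_eq_iff det_matrix_complex_mult J_def indicator_def)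
      (metis c2v_v2c imageI)
  ultimately have "((\<lambda>v. \<bar>det (matrix (?g' v))\<bar>) has_integral r) (c2v ` E)"
    by (simp only: has_integral_restrict_UNIV)
  then have *: "?g ` (c2v ` E) \<in> lmeasurable \<and> measure lebesgue (?g ` (c2v ` E)) = r"
    using has_measure_differentiable_image[OF _ der injg] sets_completionI_sets[of _ lborel] cE
    by simp
  have im: "?g ` (c2v ` E) = c2v ` (f ` E)" by (auto simp: image_image)
  have cfE: "c2v ` (f ` E) \<in> sets borel"
    using fE by (rule c2v_image_measurable)
  have "emeasure lborel (f ` E) = emeasure lborel (c2v ` (f ` E))"
    using emeasure_lborel_c2v_image[OF fE] by simp
  also have "\<dots> = emeasure lebesgue (c2v ` (f ` E))"
    using cfE by simp
  also have "\<dots> = ennreal r"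
    using * im by (metis emeasure_eq_measure2 fmeasurableD2)
  finally show ?thesis using I_eq r by simp
qed


lemma nn_integral_injective_holomorphic:
  assumes holf: "f holomorphic_on U" and "open U" and inj: "inj_on f U"
    and C: "\<And>z. z \<in> U \<Longrightarrow> cmod (deriv f z) \<le> C" and fin: "emeasure lborel U < \<infinity>"
  obtains g where "\<And>z. z \<in> U \<Longrightarrow> g (f z) = z" "f ` U \<in> sets borel" "g \<in> borel_measurable borel"
    "\<And>\<phi>. \<phi> \<in> borel_measurable borel \<Longrightarrow>
      (\<integral>\<^sup>+ z. indicator U z * (ennreal ((cmod (deriv f z))\<^sup>2) * \<phi> z) \<partial>lborel) =
      (\<integral>\<^sup>+ x. indicator (f ` U) x * \<phi> (g x) \<partial>lborel)"
proof -
  obtain g0 where g0: "g0 holomorphic_on f ` U" "\<And>z. z \<in> U \<Longrightarrow> g0 (f z) = z"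
    using holomorphic_has_inverse[OF holf \<open>open U\<close> inj] by metis
  have opf: "open (f ` U)"
    by (rule open_mapping_thm3[OF holf \<open>open U\<close> inj])
  \<comment> \<open>Extension of the inverse by 0 makes it Borel measurable on the whole
    plane.\<close>
  define g where "g x = indicator (f ` U) x *\<^sub>R g0 x" for x
  have gf: "g (f z) = z" if "z \<in> U" for z using that g0 by (simp add: g_def)
  have [measurable]: "U \<in> sets borel" "f ` U \<in> sets borel" using opf \<open>open U\<close> by auto
  have g_meas [measurable]: "g \<in> borel_measurable borel"
    unfolding g_def using holomorphic_on_imp_continuous_on[OF g0(1)]
    by (intro borel_measurable_continuous_on_indicator) auto
  define J where "J z = indicator U z *\<^sub>R (cmod (deriv f z))\<^sup>2" for z
  have "continuous_on U (\<lambda>z. (cmod (deriv f z))\<^sup>2)"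
    using holf \<open>open U\<close> by (intro continuous_intros holomorphic_on_imp_continuous_on holomorphic_deriv)
  then have J_meas [measurable]: "J \<in> borel_measurable borel"
    unfolding J_def by (intro borel_measurable_continuous_on_indicator) auto
  have eq: "density lborel (\<lambda>z. ennreal (J z)) = distr (density lborel (indicator (f ` U))) borel g"
  proof (rule measure_eqI)
    fix E assume "E \<in> sets (density lborel (\<lambda>z. ennreal (J z)))"
    then have [measurable]: "E \<in> sets borel" by simp
    have im: "f ` (U \<inter> E) = f ` U \<inter> g -` E"
      using gf by (auto simp: image_iff) 
    have "f ` U \<inter> g -` E \<in> sets borel"
      using measurable_sets[OF g_meas, of E] by auto
    with im have im_meas: "f ` (U \<inter> E) \<in> sets borel" by simp
    have "emeasure (density lborel (\<lambda>z. ennreal (J z))) E = (\<integral>\<^sup>+ z. ennreal (J z) * indicator E z \<partial>lborel)"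
      by (simp add: emeasure_density)
    also have "\<dots> = (\<integral>\<^sup>+ z. indicator (U \<inter> E) z * ennreal ((cmod (deriv f z))\<^sup>2) \<partial>lborel)"
      by (rule nn_integral_cong) (auto simp: J_def indicator_def)
    also have "\<dots> = emeasure lborel (f ` (U \<inter> E))"
    proof (rule emeasure_injective_holomorphic_image[OF holf \<open>open U\<close> inj, symmetric])
      show "emeasure lborel (U \<inter> E) < \<infinity>"
        by (rule le_less_trans[OF emeasure_mono fin]) auto
    qed (use im_meas C in auto)
    also have "\<dots> = (\<integral>\<^sup>+ x. indicator (f ` (U \<inter> E)) x \<partial>lborel)"
      using im_meas by simp
    also have "\<dots> = (\<integral>\<^sup>+ x. indicator (f ` U) x * indicator (g -` E) x \<partial>lborel)"
      by (rule nn_integral_cong) (auto simp: im indicator_def)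
    also have "\<dots> = emeasure (distr (density lborel (indicator (f ` U))) borel g) E"
      using measurable_sets[OF g_meas, of E]
      by (simp add: emeasure_distr emeasure_density)
    finally show "emeasure (density lborel (\<lambda>z. ennreal (J z))) E =
        emeasure (distr (density lborel (indicator (f ` U))) borel g) E" .
  qed simp
  show thesis
  proof
    fix \<phi> :: "complex \<Rightarrow> ennreal" assume [measurable]: "\<phi> \<in> borel_measurable borel"
    have "(\<integral>\<^sup>+ z. indicator U z * (ennreal ((cmod (deriv f z))\<^sup>2) * \<phi> z) \<partial>lborel) =
          (\<integral>\<^sup>+ z. ennreal (J z) * \<phi> z \<partial>lborel)"
      by (rule nn_integral_cong) (auto simp: J_def indicator_def)
    also have "\<dots> = (\<integral>\<^sup>+ z. \<phi> z \<partial>density lborel (\<lambda>z. ennreal (J z)))"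
      by (subst nn_integral_density) auto
    also have "\<dots> = (\<integral>\<^sup>+ x. indicator (f ` U) x * \<phi> (g x) \<partial>lborel)"
      unfolding eq by (subst nn_integral_distr) (auto simp: nn_integral_density)
    finally show "(\<integral>\<^sup>+ z. indicator U z * (ennreal ((cmod (deriv f z))\<^sup>2) * \<phi> z) \<partial>lborel) =
        (\<integral>\<^sup>+ x. indicator (f ` U) x * \<phi> (g x) \<partial>lborel)" .
  qed (use gf in auto)
qed

text \<open>The area formula as an inequality. Critical points contribute nothing to the left side;
  the rest of the plane is cut into countably many disjoint Borel pieces on which \<open>f\<close>
  is injective. The inverse branches belonging to distinct pieces have distinct values at
  \<open>x\<close>, so every partial sum runs over a finite part of the fibre. Neither measurability
  of \<open>W\<close> nor a count of the preimages enters.\<close>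

lemma nn_integral_fibre_sum_le:
  fixes f :: "complex \<Rightarrow> complex" and k W :: "complex \<Rightarrow> ennreal"
  assumes holf: "f holomorphic_on UNIV" and k [measurable]: "k \<in> borel_measurable borel"
    and W: "\<And>x Y. finite Y \<Longrightarrow> (\<And>y. y \<in> Y \<Longrightarrow> f y = x) \<Longrightarrow> (\<Sum>y\<in>Y. k y) \<le> W x"
  shows "(\<integral>\<^sup>+ y. ennreal ((cmod (deriv f y))\<^sup>2) * k y \<partial>lborel) \<le> (\<integral>\<^sup>+ x. W x \<partial>lborel)"
proof -
  let ?P = "\<lambda>U. open U \<and> inj_on f U \<and> (\<exists>C. \<forall>z\<in>U. cmod (deriv f z) \<le> C) \<and> emeasure lborel U < \<infinity>"
  have contd: "continuous_on UNIV (deriv f)"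
    using holf by (intro holomorphic_on_imp_continuous_on holomorphic_deriv) auto
  have ex: "\<exists>U. ?P U \<and> z \<in> U" if nz: "deriv f z \<noteq> 0" for z
  proof -
    obtain r where r: "r > 0" "inj_on f (ball z r)"
      using has_complex_derivative_locally_injective[OF holf _ _ nz] by auto
    have "compact (deriv f ` cball z r)"
      by (intro compact_continuous_image continuous_on_subset[OF contd]) auto
    then obtain C where C: "\<forall>x\<in>deriv f ` cball z r. cmod x \<le> C"
      using compact_imp_bounded bounded_iff by metis
    have "?P (ball z r)"
      using r C emeasure_bounded_finite[of "ball z r"] by force
    with r show ?thesis by (metis centre_in_ball)
  qed
  obtain \<F> where \<F>: "\<F> \<subseteq> Collect ?P" "countable \<F>" "\<Union>\<F> = \<Union>(Collect ?P)"
    using Lindelof[of "Collect ?P"] by auto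
  \<comment> \<open>The added empty set makes the family nonempty, so that it can be enumerated even
    if \<open>f\<close> has only critical points.\<close>
  define U where "U = from_nat_into (insert {} \<F>)"
  have rngU: "range U = insert {} \<F>"
    unfolding U_def using \<F>(2) by (simp add: range_from_nat_into)
  have PU: "?P (U i)" for i
  proof -
    have "U i \<in> insert {} \<F>" using rngU by auto
    then show ?thesis using \<F>(1) by auto
  qed
  have cover: "z \<in> (\<Union>i. U i)" if "deriv f z \<noteq> 0" for z
    using ex[OF that] \<F>(3) rngU by auto
  define S where "S = disjointed U"
  have [measurable]: "U i \<in> sets borel" for i using PU by auto
  have S_meas [measurable]: "S i \<in> sets borel" for i
    unfolding S_def disjointed_def by measurable
  have SU: "S i \<subseteq> U i" for i by (simp add: S_def disjointed_subset)
  have disj: "disjoint_family S" by (simp add: S_def disjoint_family_disjointed)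
  have US: "(\<Union>i. S i) = (\<Union>i. U i)" by (simp add: S_def UN_disjointed_eq)
  define Q where "Q i g \<longleftrightarrow> (\<forall>z\<in>U i. g (f z) = z) \<and> f ` U i \<in> sets borel \<and> g \<in> borel_measurable borel \<and>
     (\<forall>\<phi>\<in>borel_measurable borel.
      (\<integral>\<^sup>+ z. indicator (U i) z * (ennreal ((cmod (deriv f z))\<^sup>2) * \<phi> z) \<partial>lborel) =
      (\<integral>\<^sup>+ x. indicator (f ` U i) x * \<phi> (g x) \<partial>lborel))" for i and g :: "complex \<Rightarrow> complex"
  have "\<exists>g. Q i g" for i
  proof -
    obtain C where C: "\<And>z. z \<in> U i \<Longrightarrow> cmod (deriv f z) \<le> C" using PU by blast
    show ?thesis
      unfolding Q_def
      by (rule nn_integral_injective_holomorphic[of f "U i" C])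
         (use C PU holomorphic_on_subset[OF holf] in auto)
  qed
  then obtain g where Q: "\<And>i. Q i (g i)" by metis
  have gf: "g i (f z) = z" if "z \<in> U i" for i z
    using Q[of i] that by (simp add: Q_def)
  have fU [measurable]: "f ` U i \<in> sets borel"
    and g_meas [measurable]: "g i \<in> borel_measurable borel" for i
    using Q[of i] by (simp_all add: Q_def)
  have cov: "(\<integral>\<^sup>+ z. indicator (U i) z * (ennreal ((cmod (deriv f z))\<^sup>2) * \<phi> z) \<partial>lborel) =
      (\<integral>\<^sup>+ x. indicator (f ` U i) x * \<phi> (g i x) \<partial>lborel)"
    if "\<phi> \<in> borel_measurable borel" for i \<phi>
    using Q[of i] that by (simp add: Q_def)
  have d_meas [measurable]: "deriv f \<in> borel_measurable borel"
    using contd by (rule borel_measurable_continuous_onI)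
  have "(\<integral>\<^sup>+ y. ennreal ((cmod (deriv f y))\<^sup>2) * k y \<partial>lborel) =
        (\<integral>\<^sup>+ y. (\<Sum>i. indicator (S i) y) * (ennreal ((cmod (deriv f y))\<^sup>2) * k y) \<partial>lborel)"
  proof (rule nn_integral_cong)
    fix y
    have "(\<Sum>i. indicator (S i) y :: ennreal) = indicator (\<Union>i. S i) y"
      by (rule suminf_indicator[OF disj])
    then show "ennreal ((cmod (deriv f y))\<^sup>2) * k y =
        (\<Sum>i. indicator (S i) y) * (ennreal ((cmod (deriv f y))\<^sup>2) * k y)"
      using cover[of y] by (cases "deriv f y = 0") (auto simp: US)
  qed
  also have "\<dots> = (\<integral>\<^sup>+ y. (\<Sum>i. indicator (U i) y * (ennreal ((cmod (deriv f y))\<^sup>2) * (indicator (S i) y * k y))) \<partial>lborel)"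
    unfolding ennreal_suminf_multc[symmetric]
    by (intro nn_integral_cong suminf_cong) (use SU in \<open>auto simp: indicator_def\<close>)
  also have "\<dots> = (\<Sum>i. \<integral>\<^sup>+ y. indicator (U i) y * (ennreal ((cmod (deriv f y))\<^sup>2) * (indicator (S i) y * k y)) \<partial>lborel)"
    by (rule nn_integral_suminf) measurable
  also have "\<dots> = (\<Sum>i. \<integral>\<^sup>+ x. indicator (f ` U i) x * (indicator (S i) (g i x) * k (g i x)) \<partial>lborel)"
    by (subst cov) auto
  also have "\<dots> = (\<integral>\<^sup>+ x. (\<Sum>i. indicator (f ` U i) x * (indicator (S i) (g i x) * k (g i x))) \<partial>lborel)"
    by (rule nn_integral_suminf[symmetric]) measurable
  also have "\<dots> \<le> (\<integral>\<^sup>+ x. W x \<partial>lborel)"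
  proof (rule nn_integral_mono, rule suminf_le_const)
    fix x n
    \<comment> \<open>The indices whose branch over \<open>x\<close> really lands in its own piece;
      all other terms vanish.\<close>
    define I where "I = {i\<in>{..<n}. x \<in> f ` U i \<and> g i x \<in> S i}"
    have injI: "inj_on (\<lambda>i. g i x) I"
      using disj by (auto simp: inj_on_def I_def disjoint_family_on_def) (metis IntI empty_iff)
    have "(\<Sum>i<n. indicator (f ` U i) x * (indicator (S i) (g i x) * k (g i x))) = (\<Sum>i\<in>I. k (g i x))"
      by (intro sum.mono_neutral_cong_right) (auto simp: I_def indicator_def)
    also have "\<dots> = (\<Sum>y\<in>(\<lambda>i. g i x) ` I. k y)"
      using injI by (simp add: sum.reindex)
    also have "\<dots> \<le> W x"
      by (rule W) (auto simp: I_def gf)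
    finally show "(\<Sum>i<n. indicator (f ` U i) x * (indicator (S i) (g i x) * k (g i x))) \<le> W x" .
  qed auto
  finally show ?thesis .
qed

section \<open>Basins of infinity\<close>

lemma basin_fin_escape:
  assumes "S > 0" "q > 1" and grow: "\<And>w. cmod w \<ge> S \<Longrightarrow> cmod (f w) \<ge> q * cmod w" and z: "cmod z \<ge> S"
  shows "z \<in> basin_fin f"
proof -
  have *: "cmod ((f ^^ n) z) \<ge> q ^ n * S" for n
  proof (induction n)
    case (Suc n)
    have "1 * S \<le> q ^ n * S" using assms by (intro mult_right_mono one_le_power) auto
    then have "cmod ((f ^^ n) z) \<ge> S" using Suc by simp
    from grow[OF this] have "q * cmod ((f ^^ n) z) \<le> cmod ((f ^^ Suc n) z)" by simp
    moreover have "q * (q ^ n * S) \<le> q * cmod ((f ^^ n) z)"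
      using Suc \<open>q > 1\<close> by (intro mult_left_mono) auto
    ultimately show ?case by (simp add: mult.assoc)
  qed (use z in simp)
  have "filterlim (\<lambda>n. norm (q ^ n)) at_top sequentially"
    using \<open>q > 1\<close> by (intro filterlim_at_infinity_imp_norm_at_top filterlim_realpow_sequentially_gt1) auto
  then have "filterlim (\<lambda>n. q ^ n) at_top sequentially"
    using \<open>q > 1\<close> by (simp add: norm_power)
  then have "filterlim (\<lambda>n. q ^ n * S) at_top sequentially"
    by (rule filterlim_at_top_mult_tendsto_pos[OF tendsto_const \<open>S > 0\<close>])
  then have "filterlim (\<lambda>n. cmod ((f ^^ n) z)) at_top sequentially"
    by (rule filterlim_at_top_mono) (use * in auto)
  then show ?thesis
    by (simp add: basin_fin_def filterlim_norm_at_top_imp_at_infinity)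
qed

lemma basin_fin_image_iff: "f z \<in> basin_fin f \<longleftrightarrow> z \<in> basin_fin f"
proof -
  have "(\<lambda>n. (f ^^ n) (f z)) = (\<lambda>n. (f ^^ Suc n) z)"
    by (simp add: fun_eq_iff funpow_swap1)
  then show ?thesis
    unfolding basin_fin_def using filterlim_sequentially_Suc[of "\<lambda>n. (f ^^ n) z" at_infinity] by simp
qed

lemma funpow_mem_basin_fin_iff: "(f ^^ n) z \<in> basin_fin f \<longleftrightarrow> z \<in> basin_fin f"
  by (induction n) (auto simp: basin_fin_image_iff)

lemma basin_fin_eventually_large:
  assumes "z \<in> basin_fin f"
  shows "\<exists>n. cmod ((f ^^ n) z) > R"
proof -
  have "filterlim (\<lambda>n. cmod ((f ^^ n) z)) at_top sequentially"
    using assms by (simp add: basin_fin_def filterlim_at_infinity_imp_norm_at_top)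
  then have "eventually (\<lambda>n. cmod ((f ^^ n) z) > R) sequentially"
    by (simp add: filterlim_at_top_dense)
  then show ?thesis by (auto dest: eventually_happens)
qed

lemma open_basin_fin:
  assumes cont: "continuous_on UNIV f" and out: "\<And>z. cmod z > R \<Longrightarrow> z \<in> basin_fin f"
  shows "open (basin_fin f)"
proof -
  have "continuous_on UNIV (f ^^ n)" for n
  proof (induction n)
    case (Suc n)
    then show ?case
      using continuous_on_compose2[OF cont, of UNIV "f ^^ n"] by (simp add: comp_def)
  qed (simp add: id_def)
  moreover have "open {z. cmod z > R}" by (intro open_Collect_less continuous_intros)
  ultimately have "open ((f ^^ n) -` {z. cmod z > R})" for n
    by (intro continuous_open_vimage) (auto simp: continuous_on_eq_continuous_at)
  moreover have "basin_fin f = (\<Union>n. (f ^^ n) -` {z. cmod z > R})"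
  proof (intro set_eqI iffI)
    fix z assume "z \<in> (\<Union>n. (f ^^ n) -` {z. cmod z > R})"
    then obtain n where "(f ^^ n) z \<in> basin_fin f" using out by auto
    then show "z \<in> basin_fin f" by (simp only: funpow_mem_basin_fin_iff)
  qed (use basin_fin_eventually_large[of _ f R] in auto)
  ultimately show ?thesis by auto
qed

section \<open>Growth of monic polynomials with arbitrary coefficients\<close>

lemma holomorphic_monic_poly [holomorphic_intros]: "monic_poly m a holomorphic_on S"
  unfolding monic_poly_def by (intro holomorphic_intros)

lemma monic_poly_large:
  assumes "m \<ge> 2"
  obtains R where "R \<ge> 1" "\<And>z. cmod z \<ge> R \<Longrightarrow> 2 * cmod z \<le> cmod (monic_poly m a z)"
    "\<And>z. cmod z \<ge> R \<Longrightarrow> cmod z ^ m / 2 \<le> cmod (monic_poly m a z)"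
    "\<And>z. cmod z \<ge> R \<Longrightarrow> cmod (monic_poly m a z) \<le> 2 * cmod z ^ m"
proof -
  define S where "S = (\<Sum>k<m. cmod (a k))"
  \<comment> \<open>The bound \<open>2 * S\<close> keeps the lower terms below half of
    \<open>|z| ^ m\<close>; the bound 4 turns the remaining half into the factor 2 over
    \<open>|z|\<close>.\<close>
  define R where "R = max 4 (2 * S)"
  have *: "cmod (monic_poly m a z - z ^ m) \<le> cmod z ^ m / 2" if z: "cmod z \<ge> R" for z
  proof -
    have "cmod (monic_poly m a z - z ^ m) \<le> (\<Sum>k<m. cmod (a k) * cmod z ^ (m - 1))"
      unfolding monic_poly_def using z
      by (auto simp: R_def norm_mult norm_power intro!: sum_norm_le mult_left_mono power_increasing)
    also have "\<dots> = S * cmod z ^ (m - 1)" by (simp add: S_def sum_distrib_right)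
    also have "\<dots> \<le> (cmod z / 2) * cmod z ^ (m - 1)"
      using z by (intro mult_right_mono) (auto simp: R_def)
    also have "\<dots> = cmod z ^ m / 2" using assms power_Suc[of "cmod z" "m - 1"] by simp
    finally show ?thesis .
  qed
  show thesis
  proof
    show "R \<ge> 1" by (simp add: R_def)
    fix z assume z: "cmod z \<ge> R"
    have n: "cmod (z ^ m) = cmod z ^ m" by (simp add: norm_power)
    show lo: "cmod z ^ m / 2 \<le> cmod (monic_poly m a z)"
      using *[OF z] n norm_triangle_sub[of "z ^ m" "monic_poly m a z"]
      by (simp add: norm_minus_commute)
    show "cmod (monic_poly m a z) \<le> 2 * cmod z ^ m"
      using *[OF z] n norm_triangle_sub[of "monic_poly m a z" "z ^ m"]
        zero_le_power[OF norm_ge_zero[of z], of m] by linarith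
    have "4 * cmod z \<le> cmod z ^ 2" using z by (auto simp: R_def power2_eq_square intro: mult_right_mono)
    also have "\<dots> \<le> cmod z ^ m" using z assms by (intro power_increasing) (auto simp: R_def)
    finally show "2 * cmod z \<le> cmod (monic_poly m a z)" using lo by simp
  qed
qed

section \<open>The transfer operator\<close>

text \<open>Vieta for the two leading coefficients, by induction on the multiset of roots.\<close>

lemma coeff_prod_mset_linear_factors:
  fixes M :: "'a::comm_ring_1 multiset"
  shows "coeff (\<Prod>x\<in>#M. [:-x, 1:]) (size M) = 1"
    and "size M = Suc n \<Longrightarrow> coeff (\<Prod>x\<in>#M. [:-x, 1:]) n = - sum_mset M"
proof -
  have deg: "degree (\<Prod>x\<in>#M. [:-x, 1:]) \<le> size M" for M :: "'a multiset"
  proof (induction M)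
    case (add x M)
    have "degree ([:-x, 1:] * (\<Prod>x\<in>#M. [:-x, 1:])) \<le> degree [:-x, 1:] + degree (\<Prod>x\<in>#M. [:-x, 1:])"
      by (rule degree_mult_le)
    with add show ?case by (auto simp: split: if_splits)
  qed simp
  show *: "coeff (\<Prod>x\<in>#M. [:-x, 1:]) (size M) = 1" for M :: "'a multiset"
  proof (induction M)
    case (add x M)
    have "coeff (\<Prod>x\<in>#M. [:-x, 1:]) (Suc (size M)) = 0"
      using deg[of M] by (intro coeff_eq_0) simp
    with add show ?case by simp
  qed simp
  show "size M = Suc n \<Longrightarrow> coeff (\<Prod>x\<in>#M. [:-x, 1:]) n = - sum_mset M"
  proof (induction M arbitrary: n)
    case (add x M)
    then show ?case
      using *[of M] by (cases n) auto
  qed simp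
qed

text \<open>Counting roots with multiplicity gives exactly \<open>m\<close> of them. Since
  \<open>m \<ge> 2\<close>, subtracting \<open>x\<close> leaves the coefficient of index
  \<open>m - 1\<close> alone, so the sum of a fibre does not depend on \<open>x\<close>.\<close>

lemma monic_poly_fibre:
  assumes "m \<ge> 2"
  obtains M where "size M = m" "set_mset M = {y. monic_poly m a y = x}" "sum_mset M = - a (m - 1)"
proof -
  define q where "q = monom 1 m + (\<Sum>k<m. monom (a k) k) - [:x:]"
  have poly_q: "poly q y = monic_poly m a y - x" for y
    by (simp add: q_def monic_poly_def poly_monom poly_sum)
  have coeff_q: "coeff q i = (if i = m then 1 else if i < m then a i else 0) - (if i = 0 then x else 0)" for i
    by (auto simp: q_def coeff_sum coeff_pCons' sum.delta')
  have "degree q = m"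
  proof (rule antisym)
    show "degree q \<le> m" using assms by (intro degree_le) (auto simp: coeff_q)
    show "m \<le> degree q" using assms by (intro le_degree) (auto simp: coeff_q)
  qed
  then have size: "size (proots q) = m" by (simp add: size_proots_complex)
  have q: "q = (\<Prod>x\<in>#proots q. [:-x, 1:])"
    using complex_poly_decompose_multiset[of q] \<open>degree q = m\<close> assms by (simp add: coeff_q)
  have "q \<noteq> 0" using \<open>degree q = m\<close> assms by auto
  show thesis
  proof
    show "sum_mset (proots q) = - a (m - 1)"
      using coeff_prod_mset_linear_factors(2)[of "proots q" "m - 1"] assms size
      by (simp add: q[symmetric] coeff_q split: if_splits)
    show "set_mset (proots q) = {y. monic_poly m a y = x}"
      using \<open>q \<noteq> 0\<close> by (simp add: poly_q)
  qed (rule size)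
qed

lemma sum_le_sum_mset:
  fixes k :: "'a \<Rightarrow> real"
  assumes "Y \<subseteq> set_mset M" "\<And>y. k y \<ge> 0"
  shows "(\<Sum>y\<in>Y. k y) \<le> (\<Sum>y\<in>#M. k y)"
proof -
  have "finite Y" using assms(1) finite_subset by blast
  have "mset_set Y \<subseteq># M"
    using assms(1) \<open>finite Y\<close> by (metis (full_types) finite_set_mset_mset_set msubset_mset_set_iff subset_imp_msubset_mset_set mset_set_set_mset_msubset subset_mset.trans finite_set_mset)
  then obtain N where "M = mset_set Y + N" by (metis subset_mset.le_iff_add)
  moreover have "0 \<le> (\<Sum>y\<in>#N. k y)" using assms(2) by (induction N) auto
  ultimately show ?thesis by (simp add: sum_unfold_sum_mset)
qed

text \<open>The transfer estimate in the model case \<open>f y = y ^ m + a 0\<close>, divided by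
  \<open>m ^ 3\<close>. All points of a fibre then have the same modulus; \<open>u\<close> is its
  square and \<open>r\<close> bounds \<open>|a 0|^2\<close>. The roots sum to 0, so the average
  weight over the fibre is \<open>u + |a 0|^2 + 2\<close>, while the weight at \<open>x\<close> is
  \<open>u ^ m + 2\<close>. The summand 1 is the room for perturbing the model.\<close>

lemma weight_polynomial_margin:
  fixes u r :: real
  assumes m: "m \<ge> 3" and u: "0 \<le> u" "u \<le> r" and r: "r \<le> 2.02" "r ^ (m-1) \<le> 4.1"
  shows "u ^ (m-1) * (u + r + 2) + 1 \<le> m * (u ^ m + 2)"
proof -
  define t where "t = u ^ (m - 1)"
  have um: "u ^ m = u * t" using m by (simp add: t_def flip: power_Suc)
  have t0: "t \<ge> 0" using u by (simp add: t_def)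
  have t4: "t \<le> 4.1"
    using power_mono[OF u(2,1), of "m-1"] r unfolding t_def by linarith
  have "t * (u + r + 2) + 1 \<le> m * (u * t + 2)"
  proof (cases "u \<le> 1")
    case True
    have "t \<le> 1" using True u by (simp add: t_def power_le_one)
    then have "t * (r + 2) \<le> 1 * (r + 2)" using u by (intro mult_right_mono) auto
    moreover have "1 * (u * t) \<le> m * (u * t)" using m u t0 by (intro mult_right_mono) auto
    moreover have "real m \<ge> 3" using m by simp
    ultimately show ?thesis using r by (simp add: algebra_simps)
  next
    case False
    show ?thesis
    proof (cases "m = 3")
      case True
      then have t: "t = u\<^sup>2" by (simp add: t_def)
      have "t * (r + 2) \<le> t * 4.02" using r t0 by (intro mult_left_mono) auto
      \<comment> \<open>With \<open>u * t\<close> moved to the right, \<open>m = 3\<close> asks for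
        \<open>t * (r + 2 - 2 * u) \<le> 5\<close>, where \<open>r + 2 \<le> 4.02\<close>. The true
        maximum, near \<open>u = 4/3\<close>, is about 2.4, so a crude split at 1.5 is
        enough.\<close>
      moreover have "u\<^sup>2 * (4.02 - 2 * u) \<le> 5"
      proof (cases "u \<le> 1.5")
        case True
        have "u\<^sup>2 * (4.02 - 2 * u) \<le> 1.5\<^sup>2 * 2.02"
          using True False u by (intro mult_mono power_mono) auto
        then show ?thesis by (simp add: power2_eq_square)
      next
        case False
        have "u\<^sup>2 * (4.02 - 2 * u) \<le> u\<^sup>2 * 1.02"
          using False by (intro mult_left_mono) auto
        also have "\<dots> \<le> 2.02\<^sup>2 * 1.02"
          using False u r by (intro mult_right_mono power_mono) auto
        finally have "u\<^sup>2 * (4.02 - 2 * u) \<le> 2.02\<^sup>2 * 1.02" .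
        then show ?thesis by (simp add: power2_eq_square)
      qed
      ultimately show ?thesis
        by (simp add: True t algebra_simps)
    next
      case n3: False
      then have m4: "real m \<ge> 4" using m by linarith
      have "3 \<le> (real m - 1) * u" using mult_mono[of 3 "real m - 1" 1 u] m4 False by auto
      then have "t * (r + 2 - (real m - 1) * u) \<le> t * (1.02)"
        using r t0 by (intro mult_left_mono) auto
      also have "\<dots> \<le> 4.1 * 1.02" using t4 by simp
      finally show ?thesis using m4 by (simp add: algebra_simps)
    qed
  qed
  then show ?thesis by (simp add: um t_def)
qed

text \<open>Up to small errors the boundary case is \<^term>\<open>R ^ (m - 1) = (2::real)\<close>; the value 2.02 leaves
  room both for the expansion outside the disk of radius R and for the margin above.\<close>

lemma escape_radius:
  assumes "m \<ge> 3"
  obtains R :: real where "R > 1" "R ^ (m - 1) = 2.02" "R\<^sup>2 \<le> 2.02" "(R\<^sup>2) ^ (m-1) \<le> 4.1"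
proof -
  define R where "R = root (m - 1) 2.02"
  have R: "R > 1" "R ^ (m - 1) = 2.02" using assms by (auto simp: R_def)
  have "R ^ 2 \<le> R ^ (m - 1)" using R assms by (intro power_increasing) auto
  moreover have "(R\<^sup>2) ^ (m-1) = (R ^ (m - 1))\<^sup>2" by (simp add: power_mult[symmetric] mult.commute)
  moreover have "(2.02::real)\<^sup>2 \<le> 4.1" by (simp add: power2_eq_square)
  ultimately show thesis using R by (intro that[of R]) (simp_all only: R)
qed

lemma has_field_derivative_monic_poly:
  "(monic_poly m a has_field_derivative (of_nat m * z ^ (m - 1) + (\<Sum>k<m. a k * (of_nat k * z ^ (k - 1))))) (at z)"
  unfolding monic_poly_def by (auto intro!: derivative_eq_intros sum.cong)

lemmas deriv_monic_poly = DERIV_imp_deriv[OF has_field_derivative_monic_poly]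

text \<open>The bound \<open>S\<close> on the powers is left open because three regimes occur: 1 in
  the unit disk, \<open>R ^ m\<close> on fibres inside the disk of radius \<open>R\<close>, and
  \<open>|z| ^ m\<close> far out. The companion for the derivative is used in the same way.\<close>

lemma norm_monic_poly_remainder_le:
  assumes a: "\<And>k. k \<in> {1..m-1} \<Longrightarrow> cmod (a k) \<le> \<delta>"
    and z: "\<And>k. k \<in> {1..m-1} \<Longrightarrow> cmod z ^ k \<le> S" and "m \<ge> 1" and "\<delta> \<ge> 0" "S \<ge> 0"
  shows "cmod (monic_poly m a z - (z ^ m + a 0)) \<le> real m * \<delta> * S"
proof -
  have "{..<m} = insert 0 {1..m-1}" using \<open>m \<ge> 1\<close> by auto
  then have "monic_poly m a z - (z ^ m + a 0) = (\<Sum>k\<in>{1..m-1}. a k * z ^ k)"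
    by (simp add: monic_poly_def)
  also have "cmod \<dots> \<le> (\<Sum>k\<in>{1..m-1}. \<delta> * S)"
    using a z \<open>\<delta> \<ge> 0\<close> by (intro sum_norm_le) (auto simp: norm_mult norm_power intro!: mult_mono)
  also have "\<dots> = real (m - 1) * (\<delta> * S)" by simp
  also have "\<dots> \<le> real m * (\<delta> * S)" using assms by (intro mult_right_mono) auto
  finally show ?thesis by (simp add: mult.assoc)
qed

lemma norm_deriv_monic_poly_remainder_le:
  assumes a: "\<And>k. k \<in> {1..m-1} \<Longrightarrow> cmod (a k) \<le> \<delta>"
    and z: "\<And>k. k \<in> {1..m-1} \<Longrightarrow> cmod z ^ (k - 1) \<le> S" and "m \<ge> 1" and "\<delta> \<ge> 0" "S \<ge> 0"
  shows "cmod (deriv (monic_poly m a) z - of_nat m * z ^ (m - 1)) \<le> real m * (real m * \<delta> * S)"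
proof -
  have "{..<m} = insert 0 {1..m-1}" using \<open>m \<ge> 1\<close> by auto
  then have "deriv (monic_poly m a) z - of_nat m * z ^ (m - 1) = (\<Sum>k\<in>{1..m-1}. a k * (of_nat k * z ^ (k - 1)))"
    by (simp add: deriv_monic_poly)
  also have "cmod \<dots> \<le> (\<Sum>k\<in>{1..m-1}. \<delta> * (real m * S))"
    using a z \<open>\<delta> \<ge> 0\<close> \<open>S \<ge> 0\<close>
    by (intro sum_norm_le) (auto simp: norm_mult norm_power intro!: mult_mono)
  also have "\<dots> = real (m - 1) * (\<delta> * (real m * S))" by simp
  also have "\<dots> \<le> real m * (\<delta> * (real m * S))" using assms by (intro mult_right_mono) auto
  finally show ?thesis by (simp add: mult_ac)
qed

text \<open>The perturbed form of the model estimate, with \<open>s\<close> the largest modulus in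
  the fibre and \<open>d * R ^ m\<close> the error of \<open>f\<close>, and of
  \<open>f' / m\<close>, against the model. The margin 1 is spent in three portions: 0.1 on the
  errors on the left, 0.6 on replacing \<open>m\<close> by \<open>m - 1/20\<close> (where
  \<open>u ^ m + 2 \<le> 10.5\<close>), and 0.3 on the error on the right.\<close>

lemma transfer_margin:
  fixes s R d :: real
  assumes m: "m \<ge> 3" and R: "R > 1" "R ^ (m - 1) = 2.02" "R\<^sup>2 \<le> 2.02" "(R\<^sup>2) ^ (m-1) \<le> 4.1"
    and s: "0 \<le> s" "s \<le> R" and d: "0 \<le> d" "d \<le> 1 / (1000 * real m)"
  shows "(s ^ (m - 1) + d * R ^ m)\<^sup>2 * (s\<^sup>2 + R\<^sup>2 + 2 + 2 * R * d)
     \<le> (real m - 1 / 20) * ((s ^ m)\<^sup>2 - 2 * (d * R ^ m) * s ^ m + 2)"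
proof -
  have m3: "real m \<ge> 3" using m by simp
  have d1: "d \<le> 1 / 3000" using d(2) m3 by (smt (verit) frac_le)
  have md: "real m * d \<le> 1 / 1000" using d m3 by (simp add: field_simps)
  define u where "u = s\<^sup>2"
  have u: "0 \<le> u" "u \<le> R\<^sup>2" using s by (auto simp: u_def intro: power_mono)
  have sm: "(s ^ m)\<^sup>2 = u ^ m" "(s ^ (m-1))\<^sup>2 = u ^ (m-1)"
    by (simp_all add: u_def power_mult[symmetric] mult.commute)
  have "(2.02::real) \<le> 1.43\<^sup>2" by (simp add: power2_eq_square)
  with R(3) have "R\<^sup>2 \<le> 1.43\<^sup>2" by linarith
  then have R43: "R \<le> 1.43" by (rule power2_le_imp_le) simp
  have Rm: "R ^ m = 2.02 * R" using R(2) m power_Suc[of R "m - 1"] by simp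
  have Rm2: "R ^ m \<le> 2.9" using Rm R43 by simp
  have sm1: "s ^ (m-1) \<le> 2.02" using power_mono[OF s(2,1), of "m-1"] R(2) by simp
  have smm: "s ^ m \<le> 2.9" using power_mono[OF s(2,1), of m] Rm2 by simp
  have um1: "u ^ (m-1) \<le> 4.1" using power_mono[OF u(2,1), of "m-1"] R(4) by simp
  have umm: "u ^ m \<le> 8.5" using power_mono[OF smm, of 2] s sm(1) by (simp add: power2_eq_square)
  have pos: "0 \<le> s ^ (m-1)" "0 \<le> s ^ m" "0 \<le> u ^ (m-1)" "0 \<le> u ^ m" "0 \<le> R ^ m" using s u R by auto
  have e: "d * R ^ m \<le> 2.9 * d" using mult_left_mono[OF Rm2 d(1)] by simp
  have e0: "0 \<le> d * R ^ m" using d pos by simp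
  have "(s ^ (m - 1) + d * R ^ m)\<^sup>2 = u ^ (m-1) + d * R ^ m * (2 * s ^ (m-1) + d * R ^ m)"
    unfolding sm(2)[symmetric] by (simp add: power2_eq_square algebra_simps)
  also have "d * R ^ m * (2 * s ^ (m-1) + d * R ^ m) \<le> (2.9 * d) * 5"
    by (rule mult_mono) (use e e0 sm1 d d1 pos in auto)
  finally have 1: "(s ^ (m - 1) + d * R ^ m)\<^sup>2 \<le> u ^ (m-1) + 15 * d" using d by simp
  have Rd: "R * d \<le> 1.43 * d" using R43 d by (intro mult_right_mono) auto
  have 2: "s\<^sup>2 + R\<^sup>2 + 2 + 2 * R * d \<le> u + R\<^sup>2 + 2 + 3 * d" using Rd d by (simp add: u_def)
  have "(s ^ (m - 1) + d * R ^ m)\<^sup>2 * (s\<^sup>2 + R\<^sup>2 + 2 + 2 * R * d)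
     \<le> (u ^ (m-1) + 15 * d) * (u + R\<^sup>2 + 2 + 3 * d)"
    using 1 2 pos d R by (intro mult_mono) auto
  also have "\<dots> = u ^ (m-1) * (u + R\<^sup>2 + 2) + u ^ (m-1) * (3 * d) + 15 * d * (u + R\<^sup>2 + 2 + 3 * d)"
    by (simp add: algebra_simps)
  also have "\<dots> \<le> u ^ (m-1) * (u + R\<^sup>2 + 2) + 4.1 * (3 * d) + 15 * d * 7"
    using um1 u R d d1 by (intro add_mono mult_left_mono mult_right_mono) auto
  also have "\<dots> \<le> u ^ (m-1) * (u + R\<^sup>2 + 2) + 0.1" using d1 by simp
  also have "\<dots> \<le> real m * (u ^ m + 2) - 0.9"
    using weight_polynomial_margin[OF m u R(3,4)] by simp
  also have "\<dots> \<le> (real m - 1 / 20) * (u ^ m + 2) - 0.3"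
    using umm by (simp add: algebra_simps)
  also have "\<dots> \<le> (real m - 1 / 20) * ((s ^ m)\<^sup>2 - 2 * (d * R ^ m) * s ^ m + 2)"
  proof -
    have "d * R ^ m * s ^ m \<le> (2.9 * d) * 2.9"
      by (rule mult_mono) (use e smm pos d in auto)
    then have "2 * (d * R ^ m) * s ^ m \<le> 17 * d" using d by simp
    moreover have "0 \<le> 2 * (d * R ^ m) * s ^ m" using e0 pos by simp
    ultimately have "(real m - 1 / 20) * (2 * (d * R ^ m) * s ^ m) \<le> real m * (17 * d)"
      by (intro mult_mono[of _ _ "2 * (d * R ^ m) * s ^ m" "17 * d"]) (use m3 in auto)
    also have "\<dots> \<le> 0.3" using md by simp
    finally show ?thesis by (simp add: sm algebra_simps)
  qed
  finally show ?thesis .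
qed

text \<open>The weight: since the roots \<open>y\<close> of \<open>f y = x\<close> sum up to \<open>- a (m - 1)\<close>, which is
  nearly 0, the average of \<open>|y - a 0|\<^sup>2\<close> is nearly \<open>|y|\<^sup>2 + |a 0|\<^sup>2\<close>, while \<open>|x - a 0|\<close> is nearly
  \<open>|y| ^ m\<close>. With the constant weight the estimate already fails for \<open>m = 3\<close>.\<close>

lemma transfer_operator_le:
  fixes m :: nat and a :: "nat \<Rightarrow> complex" and R \<delta> :: real and x :: complex
  defines "f \<equiv> monic_poly m a"
  assumes m: "m \<ge> 3" and R: "R > 1" "R ^ (m - 1) = 2.02" "R\<^sup>2 \<le> 2.02" "(R\<^sup>2) ^ (m-1) \<le> 4.1"
    and a: "\<And>k. k \<in> {1..m-1} \<Longrightarrow> cmod (a k) \<le> \<delta>" and \<delta>: "0 \<le> \<delta>" "\<delta> \<le> 1 / (1000 * (real m)\<^sup>2)"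
    and c: "cmod (a 0) \<le> R"
    and fibre: "\<And>y. f y = x \<Longrightarrow> cmod y \<le> R"
    and Y: "\<And>y. y \<in> Y \<Longrightarrow> f y = x"
  shows "(\<Sum>y\<in>Y. (cmod (deriv f y))\<^sup>2 * ((cmod (y - a 0))\<^sup>2 + 2))
     \<le> real m ^ 3 * (real m - 1 / 20) * ((cmod (x - a 0))\<^sup>2 + 2)"
proof -
  define d where "d = real m * \<delta>"
  have d: "0 \<le> d" "d \<le> 1 / (1000 * real m)"
    using m \<delta> by (auto simp: d_def field_simps power2_eq_square)
  obtain M where M: "size M = m" "set_mset M = {y. f y = x}" "sum_mset M = - a (m - 1)"
    using monic_poly_fibre[of m a x] m unfolding f_def by auto
  have Mne: "cmod ` set_mset M \<noteq> {}" using M(1) m by auto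
  \<comment> \<open>In the perturbed fibre the moduli differ. The maximum bounds every
    \<open>|f' y|\<close> from above and, being attained at \<open>y0\<close>, also bounds
    \<open>|x - a 0|\<close> from below.\<close>
  define s where "s = Max (cmod ` set_mset M)"
  have sge: "cmod y \<le> s" if "y \<in># M" for y unfolding s_def using that by auto
  have "s \<in> cmod ` set_mset M" unfolding s_def using Mne by (intro Max_in) auto
  then obtain y0 where y0: "y0 \<in># M" "s = cmod y0" by auto
  have s: "0 \<le> s" "s \<le> R" using y0 fibre M(2) by auto
  have powR: "cmod y ^ k \<le> R ^ m" if "f y = x" "k \<le> m" for y k
  proof -
    have "cmod y ^ k \<le> R ^ k" using fibre[OF that(1)] by (intro power_mono) auto
    also have "\<dots> \<le> R ^ m" using R that by (intro power_increasing) auto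
    finally show ?thesis .
  qed
  have x: "s ^ m - d * R ^ m \<le> cmod (x - a 0)"
  proof -
    have fy: "f y0 = x" using y0 M by auto
    have "cmod (monic_poly m a y0 - (y0 ^ m + a 0)) \<le> real m * \<delta> * R ^ m"
      using m R \<delta> a powR[OF fy] by (intro norm_monic_poly_remainder_le) auto
    then have "cmod (x - a 0 - y0 ^ m) \<le> d * R ^ m"
      using fy by (simp add: f_def d_def algebra_simps)
    moreover have "cmod (y0 ^ m) \<le> cmod (x - a 0) + cmod (x - a 0 - y0 ^ m)"
      by (metis norm_minus_commute norm_triangle_sub add.commute)
    ultimately show ?thesis using y0(2) by (simp add: norm_power)
  qed
  have x2: "(s ^ m)\<^sup>2 - 2 * (d * R ^ m) * s ^ m \<le> (cmod (x - a 0))\<^sup>2"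
  proof (cases "d * R ^ m \<le> s ^ m")
    case True
    then have "(s ^ m - d * R ^ m)\<^sup>2 \<le> (cmod (x - a 0))\<^sup>2" using x by (intro power_mono) auto
    then show ?thesis by (simp add: power2_diff algebra_simps) (smt (verit) zero_le_power2 mult_nonneg_nonneg power_mult_distrib)
  next
    case False
    have "0 \<le> d * R ^ m" using d R by simp
    with False have "s ^ m - 2 * (d * R ^ m) \<le> 0" by linarith
    then have "s ^ m * (s ^ m - 2 * (d * R ^ m)) \<le> 0"
      using s by (intro mult_nonneg_nonpos) auto
    then show ?thesis by (simp add: power2_eq_square algebra_simps) (smt (verit) zero_le_square)
  qed
  define D where "D = s ^ (m - 1) + d * R ^ m"
  have D0: "D \<ge> 0" using s d R by (simp add: D_def)
  have der: "cmod (deriv f y) \<le> real m * D" if "y \<in># M" for y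
  proof -
    have fy: "f y = x" using that M by auto
    have "cmod (deriv f y - of_nat m * y ^ (m - 1)) \<le> real m * (real m * \<delta> * R ^ m)"
      unfolding f_def
      using m R \<delta> a powR[OF fy] by (intro norm_deriv_monic_poly_remainder_le) auto
    then have "cmod (deriv f y) \<le> cmod (of_nat m * y ^ (m - 1)) + real m * (d * R ^ m)"
      by (smt (verit) d_def norm_triangle_sub)
    also have "cmod (of_nat m * y ^ (m - 1)) \<le> real m * s ^ (m-1)"
      using sge[OF that] by (auto simp: norm_mult norm_power intro!: mult_left_mono power_mono)
    finally show ?thesis by (simp add: D_def algebra_simps)
  qed
  \<comment> \<open>Expanding the squares shows that the only cross term is the one with the sum of
    the roots, which is \<open>- a (m - 1)\<close> and hence small.\<close>
  have sumsq: "(\<Sum>y\<in>#M. (cmod (y - w))\<^sup>2 + 2) = (\<Sum>y\<in>#M. (cmod y)\<^sup>2) + size M * ((cmod w)\<^sup>2 + 2) - 2 * Re (cnj w * sum_mset M)" 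
    for M and w :: complex
  proof (induction M)
    case (add x M)
    have "(cmod (x - w))\<^sup>2 = (cmod x)\<^sup>2 + (cmod w)\<^sup>2 - 2 * Re (cnj w * x)"
      unfolding cmod_power2 by (simp add: power2_eq_square algebra_simps)
    with add show ?case by (simp add: algebra_simps)
  qed simp
  have "(\<Sum>y\<in>Y. (cmod (deriv f y))\<^sup>2 * ((cmod (y - a 0))\<^sup>2 + 2)) 
      \<le> (\<Sum>y\<in>#M. (cmod (deriv f y))\<^sup>2 * ((cmod (y - a 0))\<^sup>2 + 2))"
    using Y M(2) by (intro sum_le_sum_mset) auto
  also have "\<dots> \<le> (\<Sum>y\<in>#M. (real m * D)\<^sup>2 * ((cmod (y - a 0))\<^sup>2 + 2))"
    using der by (intro sum_mset_mono mult_right_mono power_mono) auto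
  also have "\<dots> = (real m * D)\<^sup>2 * (\<Sum>y\<in>#M. (cmod (y - a 0))\<^sup>2 + 2)"
    by (simp add: sum_mset_distrib_left)
  also have "\<dots> \<le> (real m * D)\<^sup>2 * (m * (s\<^sup>2 + R\<^sup>2 + 2 + 2 * R * d))"
  proof (rule mult_left_mono)
    have "(\<Sum>y\<in>#M. (cmod y)\<^sup>2) \<le> (\<Sum>y\<in>#M. s\<^sup>2)"
      using sge by (intro sum_mset_mono power_mono) auto
    also have "\<dots> = m * s\<^sup>2" using M(1) by simp
    finally have 1: "(\<Sum>y\<in>#M. (cmod y)\<^sup>2) \<le> m * s\<^sup>2" .
    have 2: "(cmod (a 0))\<^sup>2 \<le> R\<^sup>2" using c by (intro power_mono) auto
    have "- Re (cnj (a 0) * sum_mset M) \<le> cmod (cnj (a 0) * sum_mset M)"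
      by (metis abs_Re_le_cmod abs_le_D2)
    also have "\<dots> = cmod (a 0) * cmod (a (m - 1))" by (simp add: M(3) norm_mult)
    also have "\<dots> \<le> R * \<delta>" using c a[of "m-1"] m \<delta> R by (intro mult_mono) auto
    also have "\<dots> \<le> R * (real m * d)"
    proof -
      have "1 * 1 \<le> real m * real m" using m by (intro mult_mono) auto
      then have "1 * \<delta> \<le> (real m * real m) * \<delta>" using \<delta> by (intro mult_right_mono) auto
      then show ?thesis using R by (intro mult_left_mono) (auto simp: d_def mult_ac)
    qed
    finally have 3: "- Re (cnj (a 0) * sum_mset M) \<le> R * (real m * d)" .
    have "real m * (cmod (a 0))\<^sup>2 \<le> real m * R\<^sup>2" using 2 by (intro mult_left_mono) auto
    then show "(\<Sum>y\<in>#M. (cmod (y - a 0))\<^sup>2 + 2) \<le> m * (s\<^sup>2 + R\<^sup>2 + 2 + 2 * R * d)"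
      using 1 3 unfolding sumsq M(1) by (simp add: algebra_simps)
  qed simp
  also have "\<dots> = real m ^ 3 * (D\<^sup>2 * (s\<^sup>2 + R\<^sup>2 + 2 + 2 * R * d))"
    by (simp add: power2_eq_square power3_eq_cube algebra_simps)
  also have "\<dots> \<le> real m ^ 3 * ((real m - 1 / 20) * ((s ^ m)\<^sup>2 - 2 * (d * R ^ m) * s ^ m + 2))"
    unfolding D_def using transfer_margin[OF m R s d] by (intro mult_left_mono) auto
  also have "\<dots> \<le> real m ^ 3 * ((real m - 1 / 20) * ((cmod (x - a 0))\<^sup>2 + 2))"
    using x2 m by (intro mult_left_mono) auto
  finally show ?thesis by (simp add: mult.assoc)
qed

section \<open>The functional equation of the Riemann map\<close>

text \<open>The maximum principle on slightly smaller closed disks; no boundary values of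
  \<open>g\<close> are needed, only that its modulus is at most \<open>1 + \<epsilon>\<close> close
  to the circle.\<close>

lemma norm_le_one_of_boundary:
  assumes hol: "g holomorphic_on ball 0 1"
    and bd: "\<And>\<epsilon>. \<epsilon> > 0 \<Longrightarrow> \<exists>t<1. \<forall>w. t < cmod w \<and> cmod w < 1 \<longrightarrow> cmod (g w) \<le> 1 + \<epsilon>"
    and w: "w \<in> ball 0 (1::real)"
  shows "cmod (g w) \<le> 1"
proof (rule field_le_epsilon)
  fix \<epsilon> :: real assume "\<epsilon> > 0"
  then obtain t where t: "t < 1" "\<And>w. t < cmod w \<Longrightarrow> cmod w < 1 \<Longrightarrow> cmod (g w) \<le> 1 + \<epsilon>"
    using bd by blast
  have "max (max t (cmod w)) 0 < 1" using w t by simp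
  then obtain s where s: "max (max t (cmod w)) 0 < s" "s < 1" using dense by blast
  show "cmod (g w) \<le> 1 + \<epsilon>"
  proof (rule maximum_modulus_frontier[of g "cball 0 s"])
    show "g holomorphic_on interior (cball 0 s)"
      using s by (intro holomorphic_on_subset[OF hol]) auto
    show "continuous_on (closure (cball 0 s)) g"
      using s by (intro continuous_on_subset[OF holomorphic_on_imp_continuous_on[OF hol]]) auto
  qed (use s t in auto)
qed

section \<open>The Riemann map near infinity and near the unit circle\<close>

text \<open>A disk automorphism moves \<open>c\<close> to 0. Its derivative at \<open>w\<close> is
  \<open>(1 - |c|^2) / (1 - cnj c * w)^2\<close>, and the denominator has modulus at most 4, so
  passing from \<open>F\<close> to \<open>G\<close> costs only a constant factor.\<close>

lemma biholo_to_disk_normalize: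
  assumes F: "biholo_to_disk A F c" and "open A"
  defines "G \<equiv> \<lambda>z. Moebius_function 0 c (F z)"
  shows "biholo_to_disk A G 0"
    and "\<And>z. z \<in> A \<Longrightarrow> cmod (deriv F z) \<le> 4 / (1 - (cmod c)\<^sup>2) * cmod (deriv G z)"
proof -
  have holF: "F holomorphic_on A" and injF: "inj_on F A" and c: "cmod c < 1"
    and cF: "c \<notin> F ` A" and imF: "F ` A = ball 0 1 - {c}"
    using F unfolding biholo_to_disk_def by auto
  obtain r where r: "r > 0" "ball 0 r - {0} \<subseteq> (\<lambda>z. 1 / z) ` A"
    "(\<lambda>w. if w = 0 then c else F (1 / w)) holomorphic_on ball 0 r"
    using F unfolding biholo_to_disk_def by auto
  let ?M = "Moebius_function 0 c"
  have "F z \<in> ball 0 1 - {c}" if "z \<in> A" for z using that unfolding imF[symmetric] by auto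
  then have bl: "F z \<in> ball 0 1" if "z \<in> A" for z using that by auto
  have Minv: "Moebius_function 0 (- c) (?M x) = x" if "x \<in> ball 0 1" for x
    using Moebius_function_compose[of "-c" c x] c that by simp
  have Minv': "?M (Moebius_function 0 (- c) x) = x" if "x \<in> ball 0 1" for x
    using Moebius_function_compose[of c "-c" x] c that by simp
  have Mbij: "?M ` ball 0 1 = ball 0 1"
  proof (intro equalityI subsetI)
    fix x :: complex assume x: "x \<in> ball 0 1"
    have "Moebius_function 0 (- c) x \<in> ball 0 1"
      using Moebius_function_norm_lt_1[of "-c" x 0] c x by simp
    with Minv'[OF x] show "x \<in> ?M ` ball 0 1" by (metis imageI)
  qed (use Moebius_function_norm_lt_1 c in auto)
  have Minj: "inj_on ?M (ball 0 1)" by (rule inj_on_inverseI) (rule Minv)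
  have Mc: "?M c = 0" by (rule Moebius_function_eq_zero)
  have imG: "G ` A = ball 0 1 - {0}"
  proof -
    have "G ` A = ?M ` (ball 0 1 - {c})" unfolding G_def imF[symmetric] by (simp add: image_image)
    also have "\<dots> = ?M ` ball 0 1 - ?M ` {c}" by (intro inj_on_image_set_diff[OF Minj]) (use c in auto)
    finally show ?thesis by (simp add: Mbij Mc)
  qed
  have holM: "?M holomorphic_on ball 0 1" by (rule Moebius_function_holomorphic[OF c])
  have "G holomorphic_on A"
    unfolding G_def using holomorphic_on_compose_gen[OF holF holM] bl by (fastforce simp: comp_def)
  moreover have "inj_on G A"
    using injF Minj bl by (auto simp: G_def inj_on_def)
  moreover have "(\<lambda>w. if w = 0 then 0 else G (1 / w)) holomorphic_on ball 0 r"
  proof -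
    have "?M \<circ> (\<lambda>w. if w = 0 then c else F (1 / w)) holomorphic_on ball 0 r"
    proof (rule holomorphic_on_compose_gen[OF r(3) holM])
      have "F (1 / w) \<in> ball 0 1" if "w \<in> ball 0 r" "w \<noteq> 0" for w
      proof -
        have "1 / w \<in> A" using r(2) that by force
        then show ?thesis by (rule bl)
      qed
      then show "(\<lambda>w. if w = 0 then c else F (1 / w)) ` ball 0 r \<subseteq> ball 0 1" using c by auto
    qed
    moreover have "?M \<circ> (\<lambda>w. if w = 0 then c else F (1 / w)) = (\<lambda>w. if w = 0 then 0 else G (1 / w))"
      by (auto simp: fun_eq_iff Mc G_def)
    ultimately show ?thesis by simp
  qed
  ultimately show "biholo_to_disk A G 0"
    unfolding biholo_to_disk_def using imG r by auto
  show "cmod (deriv F z) \<le> 4 / (1 - (cmod c)\<^sup>2) * cmod (deriv G z)" if z: "z \<in> A" for z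
  proof -
    have Fz: "cmod (F z) < 1" using bl[OF z] by simp
    have nc: "cmod (cnj c * F z) < 1"
      using mult_strict_mono'[of "cmod c" 1 "cmod (F z)" 1] c Fz by (simp add: norm_mult)
    then have nz: "1 - cnj c * F z \<noteq> 0" by auto
    have dF: "(F has_field_derivative deriv F z) (at z)"
      using holF \<open>open A\<close> z by (rule holomorphic_derivI)
    have d1: "((\<lambda>z. F z - c) has_field_derivative deriv F z) (at z)"
      using DERIV_diff[OF dF DERIV_const[of c]] by simp
    have d2: "((\<lambda>z. 1 - cnj c * F z) has_field_derivative - (cnj c * deriv F z)) (at z)"
      using DERIV_diff[OF DERIV_const[of 1] DERIV_cmult[OF dF, of "cnj c"]] by simp
    have "deriv G z = (deriv F z * (1 - cnj c * F z) - (F z - c) * (- (cnj c * deriv F z))) / ((1 - cnj c * F z) * (1 - cnj c * F z))"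
      unfolding G_def Moebius_function_simple
      by (rule DERIV_imp_deriv) (rule DERIV_divide[OF d1 d2 nz])
    also have "\<dots> = deriv F z * (1 - c * cnj c) / (1 - cnj c * F z)\<^sup>2"
      by (simp add: algebra_simps power2_eq_square)
    also have "1 - c * cnj c = of_real (1 - (cmod c)\<^sup>2)" by (simp add: complex_norm_square[symmetric])
    finally have "deriv F z * of_real (1 - (cmod c)\<^sup>2) = deriv G z * (1 - cnj c * F z)\<^sup>2"
      using nz by simp
    then have "cmod (deriv F z * of_real (1 - (cmod c)\<^sup>2)) = cmod (deriv G z * (1 - cnj c * F z)\<^sup>2)" by simp
    then have "cmod (deriv F z) * \<bar>1 - (cmod c)\<^sup>2\<bar> = cmod (deriv G z) * cmod (1 - cnj c * F z) ^ 2"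
      unfolding norm_mult norm_power norm_of_real .
    also have "cmod (1 - cnj c * F z) ^ 2 \<le> 2 ^ 2"
      using norm_triangle_ineq4[of 1 "cnj c * F z"] nc by (intro power_mono) auto
    finally have *: "cmod (deriv F z) * \<bar>1 - (cmod c)\<^sup>2\<bar> \<le> cmod (deriv G z) * 4"
      by (simp add: mult_left_mono)
    have "(cmod c)\<^sup>2 < 1" using c by (simp add: power_less_one_iff)
    with * show ?thesis by (simp add: field_simps)
  qed
qed

text \<open>\<open>G\<close> has a simple zero at infinity: in the chart \<open>w = 1 / z\<close> it
  becomes an injective holomorphic \<open>H\<close> with \<open>H 0 = 0\<close>, so
  \<open>H w / w\<close> tends to \<open>deriv H 0 \<noteq> 0\<close>.\<close>

lemma biholo_to_disk_at_infinity:
  assumes G: "biholo_to_disk A G 0"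
  obtains \<rho> \<alpha> \<beta> where "\<rho> > 0" "\<alpha> > 0" "\<beta> > 0"
    "\<And>z. cmod z \<ge> \<rho> \<Longrightarrow> z \<in> A \<and> \<alpha> \<le> cmod (G z) * cmod z \<and> cmod (G z) * cmod z \<le> \<beta>"
proof -
  have holG: "G holomorphic_on A" and injG: "inj_on G A" and imG: "G ` A = ball 0 1 - {0}"
    using G unfolding biholo_to_disk_def by auto
  define H where "H w = (if w = 0 then 0 else G (1 / w))" for w
  obtain r where r: "r > 0" "ball 0 r - {0} \<subseteq> (\<lambda>z. 1 / z) ` A" "H holomorphic_on ball 0 r"
    using G unfolding biholo_to_disk_def H_def by auto
  have inA: "1 / w \<in> A" if "w \<in> ball 0 r" "w \<noteq> 0" for w using r(2) that by force
  have injH: "inj_on H (ball 0 r)"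
  proof (rule inj_onI)
    fix x y assume xy: "x \<in> ball 0 r" "y \<in> ball 0 r" "H x = H y"
    have nz: "G (1 / w) \<noteq> 0" if "w \<in> ball 0 r" "w \<noteq> 0" for w using inA[OF that] imG by auto
    have "1 / x = 1 / y" if "x \<noteq> 0" "y \<noteq> 0"
      using xy that inA[of x] inA[of y] inj_onD[OF injG, of "1 / x" "1 / y"] by (simp add: H_def)
    moreover have "x = 0 \<longleftrightarrow> y = 0"
      using xy nz[of x] nz[of y] by (cases "x = 0"; cases "y = 0") (simp_all add: H_def)
    ultimately show "x = y"
      by (metis divide_divide_eq_right div_by_1 mult_1)
  qed
  have d0: "deriv H 0 \<noteq> 0"
    using holomorphic_injective_imp_regular[OF r(3) _ injH] r(1) by auto
  define D where "D = cmod (deriv H 0)"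
  have "(H has_field_derivative deriv H 0) (at 0)"
    using holomorphic_derivI[OF r(3)] r(1) by auto
  then have "((\<lambda>w. H w / w) \<longlongrightarrow> deriv H 0) (at 0)"
    by (simp add: has_field_derivative_iff H_def)
  then have "((\<lambda>w. cmod (H w / w)) \<longlongrightarrow> D) (at 0)" unfolding D_def by (rule tendsto_norm)
  then have "eventually (\<lambda>w. dist (cmod (H w / w)) D < D / 2) (at 0)"
    using d0 by (intro tendstoD) (auto simp: D_def)
  then obtain s where s: "s > 0" "\<And>w. w \<noteq> 0 \<Longrightarrow> cmod w < s \<Longrightarrow> dist (cmod (H w / w)) D < D / 2"
    unfolding eventually_at by auto
  define \<rho> where "\<rho> = 2 / min r s"
  have D0: "D > 0" using d0 by (simp add: D_def)
  show thesis
  proof (rule that[of \<rho> "D / 2" "2 * D"])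
    fix z assume z: "cmod z \<ge> \<rho>"
    have \<rho>: "\<rho> > 0" using r s by (simp add: \<rho>_def)
    have z0: "z \<noteq> 0" using z \<rho> by auto
    have "cmod (1 / z) \<le> 1 / \<rho>" using z \<rho> by (simp add: norm_divide frac_le)
    also have "\<dots> < min r s" using r s by (auto simp: \<rho>_def min_def)
    finally have w: "cmod (1 / z) < r" "cmod (1 / z) < s" by auto
    have "dist (cmod (H (1 / z) / (1 / z))) D < D / 2" using s(2)[of "1 / z"] w z0 by auto
    moreover have "cmod (H (1 / z) / (1 / z)) = cmod (G z) * cmod z" using z0 by (simp add: H_def norm_mult)
    ultimately have "\<bar>cmod (G z) * cmod z - D\<bar> < D / 2" by (simp only: dist_real_def)
    moreover have "z \<in> A" using inA[of "1 / z"] w z0 by auto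
    ultimately show "z \<in> A \<and> D / 2 \<le> cmod (G z) * cmod z \<and> cmod (G z) * cmod z \<le> 2 * D"
      using D0 by arith
  qed (use r s D0 in \<open>auto simp: \<rho>_def\<close>)
qed

text \<open>By the open mapping theorem, values near 0 are already taken near infinity, and
  injectivity forbids taking them again at bounded points.\<close>

lemma biholo_to_disk_bounded_below:
  assumes G: "biholo_to_disk A G 0"
  obtains b where "b > 0" "\<And>z. z \<in> A \<Longrightarrow> cmod z \<le> M \<Longrightarrow> cmod (G z) \<ge> b"
proof -
  have injG: "inj_on G A" and imG: "G ` A = ball 0 1 - {0}"
    using G unfolding biholo_to_disk_def by auto
  define H where "H w = (if w = 0 then 0 else G (1 / w))" for w
  obtain r where r: "r > 0" "ball 0 r - {0} \<subseteq> (\<lambda>z. 1 / z) ` A" "H holomorphic_on ball 0 r"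
    using G unfolding biholo_to_disk_def H_def by auto
  have inA: "1 / w \<in> A" if "w \<in> ball 0 r" "w \<noteq> 0" for w using r(2) that by force
  have Hnz: "H w \<noteq> 0" if "w \<in> ball 0 r" "w \<noteq> 0" for w
    using inA[OF that] that imG by (auto simp: H_def)
  \<comment> \<open>The second bound makes \<open>|w| < s\<close> imply
    \<open>|1 / w| > M\<close>.\<close>
  define s where "s = min r (1 / max M 1)"
  have s: "s > 0" "s \<le> r" using r by (auto simp: s_def)
  have nc: "\<not> H constant_on ball 0 r"
  proof
    assume "H constant_on ball 0 r"
    then have "H (of_real (r / 2)) = H 0" using r(1) unfolding constant_on_def by (force simp: norm_divide)
    then show False using Hnz[of "of_real (r / 2)"] r(1) by (simp add: H_def norm_divide split: if_splits)
  qed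
  have "open (H ` ball 0 s)"
    by (rule open_mapping_thm[OF r(3) _ _ _ _ nc]) (use s in auto)
  moreover have "0 \<in> H ` ball 0 s" using s by (intro image_eqI[of _ _ 0]) (auto simp: H_def)
  ultimately obtain b where b: "b > 0" "ball 0 b \<subseteq> H ` ball 0 s" using open_contains_ball by blast
  show thesis
  proof
    fix z assume z: "z \<in> A" "cmod z \<le> M"
    show "cmod (G z) \<ge> b"
    proof (rule ccontr)
      assume "\<not> cmod (G z) \<ge> b"
      then have "G z \<in> H ` ball 0 s" using b by auto
      then obtain w where w: "cmod w < s" "G z = H w" by auto
      have "G z \<noteq> 0" using imG z by auto
      then have w0: "w \<noteq> 0" using w by (auto simp: H_def)
      then have "G z = G (1 / w)" "1 / w \<in> A" using w s inA[of w] by (auto simp: H_def)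
      then have "z = 1 / w" using injG z by (auto simp: inj_on_def)
      then have "cmod w * cmod z = 1" using w0 by (simp add: norm_divide)
      moreover have "cmod w * cmod z \<le> cmod w * max M 1" using z by (intro mult_left_mono) auto
      moreover have "cmod w * max M 1 < (1 / max M 1) * max M 1"
        using w by (intro mult_strict_right_mono) (auto simp: s_def)
      moreover have "(1 / max M 1) * max M 1 = 1" by (simp add: max_def)
      ultimately show False by linarith
    qed
  qed (use b in auto)
qed

text \<open>Properness of \<open>f\<close> on the basin. Points with
  \<open>|G (f z)| \<le> r\<close> either have large modulus, where \<open>|G z| \<le> 1/2\<close>,
  or form a compact subset \<open>Z\<close> of \<open>A\<close>, on which \<open>|G|\<close> has a
  maximum below 1.\<close>

lemma biholo_to_disk_proper:
  assumes G: "biholo_to_disk A G 0" and "open A" and cont: "continuous_on UNIV f"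
    and inv: "\<And>z. f z \<in> A \<longleftrightarrow> z \<in> A" and "r < 1"
  shows "\<exists>t<1. \<forall>z\<in>A. t < cmod (G z) \<longrightarrow> r < cmod (G (f z))"
proof -
  have holG: "G holomorphic_on A" and injG: "inj_on G A" and imG: "G ` A = ball 0 1 - {0}"
    using G unfolding biholo_to_disk_def by auto
  obtain \<rho> \<alpha> \<beta> where \<rho>: "\<rho> > 0" "\<beta> > 0" "\<And>z. cmod z \<ge> \<rho> \<Longrightarrow> z \<in> A \<and> cmod (G z) * cmod z \<le> \<beta>"
    using biholo_to_disk_at_infinity[OF G] by metis
  define R where "R = max \<rho> (2 * \<beta>)"
  have far: "cmod (G z) \<le> 1 / 2" if "cmod z > R" for z
  proof -
    have "cmod (G z) * (2 * \<beta>) \<le> cmod (G z) * cmod z" using that by (intro mult_left_mono) (auto simp: R_def)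
    also have "\<dots> \<le> \<beta>" using \<rho>(3)[of z] that by (auto simp: R_def)
    finally show ?thesis using \<rho> by simp
  qed
  have "compact (f ` cball 0 R)" by (intro compact_continuous_image continuous_on_subset[OF cont]) auto
  then obtain M where M: "\<And>z. z \<in> cball 0 R \<Longrightarrow> cmod (f z) \<le> M"
    using compact_imp_bounded bounded_iff by (metis imageI)
  obtain b where b: "b > 0" "\<And>z. z \<in> A \<Longrightarrow> cmod z \<le> M \<Longrightarrow> cmod (G z) \<ge> b"
    using biholo_to_disk_bounded_below[OF G] by blast
  obtain \<psi> where \<psi>: "\<psi> holomorphic_on G ` A" "\<And>z. z \<in> A \<Longrightarrow> \<psi> (G z) = z"
    using holomorphic_has_inverse[OF holG \<open>open A\<close> injG] by metis
  define K where "K = \<psi> ` (cball 0 r - ball 0 b)"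
  have sub: "cball 0 r - ball 0 b \<subseteq> G ` A" using b \<open>r < 1\<close> by (auto simp: imG)
  have "compact K"
    unfolding K_def
    by (intro compact_continuous_image continuous_on_subset[OF holomorphic_on_imp_continuous_on[OF \<psi>(1)] sub] compact_diff) auto
  have KA: "K \<subseteq> A" using sub \<psi>(2) by (auto simp: K_def)
  define Z where "Z = cball 0 R \<inter> f -` K"
  have "closed (f -` K)"
    using \<open>compact K\<close> cont by (intro continuous_closed_vimage compact_imp_closed) (auto simp: continuous_on_eq_continuous_at)
  then have "compact Z" unfolding Z_def by (intro compact_Int_closed) auto
  have ZA: "Z \<subseteq> A" using KA inv by (auto simp: Z_def)
  have mem: "z \<in> Z" if "z \<in> A" "cmod z \<le> R" "cmod (G (f z)) \<le> r" for z
  proof -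
    have fA: "f z \<in> A" using that inv by simp
    have "cmod (f z) \<le> M" using M that by auto
    then have "G (f z) \<in> cball 0 r - ball 0 b" using b(2)[OF fA] that by auto
    then have "f z \<in> K" using \<psi>(2)[OF fA] unfolding K_def by (metis imageI)
    then show ?thesis using that by (auto simp: Z_def)
  qed
  have "\<exists>t<1. \<forall>z\<in>Z. cmod (G z) \<le> t"
  proof (cases "Z = {}")
    case False
    have "continuous_on Z (\<lambda>z. cmod (G z))"
      by (intro continuous_on_norm continuous_on_subset[OF holomorphic_on_imp_continuous_on[OF holG] ZA])
    then obtain z0 where z0: "z0 \<in> Z" "\<forall>z\<in>Z. cmod (G z) \<le> cmod (G z0)"
      using continuous_attains_sup[OF \<open>compact Z\<close> False] by blast
    moreover have "G z0 \<in> ball 0 1 - {0}" using ZA z0 unfolding imG[symmetric] by auto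
    ultimately show ?thesis by (intro exI[of _ "cmod (G z0)"]) auto
  qed (use zero_less_one in blast)
  then obtain t where t: "t < 1" "\<And>z. z \<in> Z \<Longrightarrow> cmod (G z) \<le> t" by blast
  show ?thesis
  proof (intro exI conjI ballI impI)
    show "max t (1 / 2) < 1" using t by simp
    fix z assume z: "z \<in> A" "max t (1 / 2) < cmod (G z)"
    then have "cmod z \<le> R" using far[of z] by force
    then show "r < cmod (G (f z))" using mem[of z] t(2)[of z] z by force
  qed
qed

text \<open>In the disk coordinate the quotient \<open>q\<close> of the two sides and its reciprocal
  \<open>p\<close> are bounded near 0, hence extend holomorphically over 0, and both have modulus at
  most \<open>1 + \<epsilon>\<close> near the circle. So both extensions are bounded by 1; as their
  product is 1, \<open>|q| = 1\<close> and \<open>q\<close> is constant.\<close>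

lemma boettcher_equation:
  fixes m :: nat and a :: "nat \<Rightarrow> complex"
  defines "f \<equiv> monic_poly m a"
  assumes m: "m \<ge> 2" and G: "biholo_to_disk (basin_fin f) G 0" and opA: "open (basin_fin f)"
  obtains \<kappa> where "cmod \<kappa> = 1" "\<And>z. z \<in> basin_fin f \<Longrightarrow> G (f z) = \<kappa> * G z ^ m"
proof -
  let ?A = "basin_fin f"
  have holG: "G holomorphic_on ?A" and injG: "inj_on G ?A" and imG: "G ` ?A = ball 0 1 - {0}"
    using G unfolding biholo_to_disk_def by auto
  have Gb: "G z \<in> ball 0 1 - {0}" if "z \<in> ?A" for z using that unfolding imG[symmetric] by auto
  have G0: "G z \<noteq> 0" and G1: "cmod (G z) < 1" if "z \<in> ?A" for z using Gb[OF that] by auto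
  have fA: "f z \<in> ?A \<longleftrightarrow> z \<in> ?A" for z by (rule basin_fin_image_iff)
  have holf: "f holomorphic_on S" for S unfolding f_def by (rule holomorphic_monic_poly)
  obtain \<psi> where \<psi>: "\<psi> holomorphic_on ball 0 1 - {0}" "\<And>z. z \<in> ?A \<Longrightarrow> \<psi> (G z) = z"
    using holomorphic_has_inverse[OF holG opA injG] imG by metis
  have \<psi>A: "\<psi> w \<in> ?A" "G (\<psi> w) = w" if "w \<in> ball 0 1 - {0}" for w
    using that \<psi>(2) unfolding imG[symmetric] by auto
  have holGf: "(\<lambda>w. G (f (\<psi> w))) holomorphic_on ball 0 1 - {0}"
  proof -
    have "(\<lambda>w. f (\<psi> w)) holomorphic_on ball 0 1 - {0}"
      using holomorphic_on_compose_gen[OF \<psi>(1) holf[of UNIV]] by (simp add: comp_def)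
    then have "G \<circ> (\<lambda>w. f (\<psi> w)) holomorphic_on ball 0 1 - {0}"
      by (rule holomorphic_on_compose_gen[OF _ holG]) (use \<psi>A(1) fA in blast)
    then show ?thesis by (simp add: comp_def)
  qed
  have Gf0: "G (f (\<psi> w)) \<noteq> 0" if "w \<in> ball 0 1 - {0}" for w using G0 \<psi>A(1)[OF that] fA by auto
  define q where "q w = G (f (\<psi> w)) / w ^ m" for w
  define p where "p w = w ^ m / G (f (\<psi> w))" for w
  have holq: "q holomorphic_on ball 0 1 - {0}"
    unfolding q_def by (intro holomorphic_intros holGf) auto
  have holp: "p holomorphic_on ball 0 1 - {0}"
    unfolding p_def by (intro holomorphic_intros holGf Gf0)
  obtain \<rho> \<alpha> \<beta> where \<rho>: "\<rho> > 0" "\<alpha> > 0" "\<beta> > 0"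
    "\<And>z. cmod z \<ge> \<rho> \<Longrightarrow> z \<in> ?A \<and> \<alpha> \<le> cmod (G z) * cmod z \<and> cmod (G z) * cmod z \<le> \<beta>"
    using biholo_to_disk_at_infinity[OF G] by metis
  obtain R where R: "R \<ge> 1" "\<And>z. cmod z \<ge> R \<Longrightarrow> 2 * cmod z \<le> cmod (f z)"
    "\<And>z. cmod z \<ge> R \<Longrightarrow> cmod z ^ m / 2 \<le> cmod (f z)"
    "\<And>z. cmod z \<ge> R \<Longrightarrow> cmod (f z) \<le> 2 * cmod z ^ m"
    using monic_poly_large[OF m, of a] unfolding f_def by metis
  define L where "L = max \<rho> R"
  obtain b where b: "b > 0" "\<And>z. z \<in> ?A \<Longrightarrow> cmod z \<le> L \<Longrightarrow> cmod (G z) \<ge> b"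
    using biholo_to_disk_bounded_below[OF G] by blast
  \<comment> \<open>Small \<open>w\<close> means \<open>z\<close> near infinity, where
    \<open>|G z|\<close> is comparable to \<open>1 / |z|\<close> and \<open>|f z|\<close> to
    \<open>X = |z| ^ m\<close>; thus \<open>|G (f z)|\<close> and \<open>|w| ^ m\<close> are both
    comparable to \<open>1 / X\<close>.\<close>
  have near: "cmod (q w) \<le> 2 * \<beta> / \<alpha> ^ m \<and> cmod (p w) \<le> 2 * \<beta> ^ m / \<alpha>"
    if w: "w \<in> ball 0 1 - {0}" "cmod w < b" for w
  proof -
    define z where "z = \<psi> w"
    have zA: "z \<in> ?A" and Gz: "G z = w" using \<psi>A[OF w(1)] by (auto simp: z_def)
    have zL: "cmod z > L" using b(2)[OF zA] Gz w by force
    have z: "cmod z \<ge> \<rho>" "cmod z \<ge> R" "cmod z \<ge> 1" using zL R by (auto simp: L_def)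
    have fz: "cmod (f z) \<ge> \<rho>" using R(2)[OF z(2)] z by linarith
    define X where "X = cmod z ^ m"
    have X: "X > 0" using z(3) unfolding X_def by (intro zero_less_power) linarith
    note g1 = \<rho>(4)[OF z(1)] and g2 = \<rho>(4)[OF fz]
    have w_lo: "\<alpha> ^ m \<le> cmod w ^ m * X" 
      using power_mono[of \<alpha> "cmod (G z) * cmod z" m] g1 \<rho> Gz by (simp add: power_mult_distrib X_def)
    have w_hi: "cmod w ^ m * X \<le> \<beta> ^ m"
      using power_mono[of "cmod (G z) * cmod z" \<beta> m] g1 Gz by (simp add: power_mult_distrib X_def)
    have f_lo: "X / 2 \<le> cmod (f z)" and f_hi: "cmod (f z) \<le> 2 * X" using R(3,4)[OF z(2)] by (auto simp: X_def)
    let ?g = "cmod (G (f z))"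
    have gp: "?g > 0" using G0 fA zA by simp
    have wp: "cmod w ^ m > 0" using w by simp
    have "?g * X \<le> 2 * (?g * cmod (f z))" using f_lo gp by (simp add: mult_left_mono)
    then have 1: "?g * X \<le> 2 * \<beta>" using g2 by linarith
    have "?g * cmod (f z) \<le> ?g * (2 * X)" using f_hi gp by (intro mult_left_mono) auto
    then have 2: "\<alpha> \<le> 2 * (?g * X)" using g2 by linarith
    have "cmod (q w) = (?g * X) / (cmod w ^ m * X)" using X by (simp add: q_def norm_divide norm_power z_def)
    also have "\<dots> \<le> 2 * \<beta> / \<alpha> ^ m" using 1 w_lo \<rho> gp X by (intro frac_le) auto
    finally have A: "cmod (q w) \<le> 2 * \<beta> / \<alpha> ^ m" .
    have "cmod (p w) = (cmod w ^ m * X) / (?g * X)" using X by (simp add: p_def norm_divide norm_power z_def)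
    also have "\<dots> \<le> \<beta> ^ m / (\<alpha> / 2)" using 2 w_hi \<rho> by (intro frac_le) auto
    finally show ?thesis using A by (simp add: mult.commute)
  qed
  have ev: "eventually (\<lambda>w. w \<in> ball 0 1 - {0} \<and> cmod w < b) (at (0::complex))"
    unfolding eventually_at using b by (intro exI[of _ "min b 1"]) auto
  have "\<forall>\<^sub>F w in at 0. cmod (q w) \<le> 2 * \<beta> / \<alpha> ^ m" "\<forall>\<^sub>F w in at 0. cmod (p w) \<le> 2 * \<beta> ^ m / \<alpha>"
    by (rule eventually_mono[OF ev]; use near in blast)+
  then obtain g h where g: "g holomorphic_on ball 0 1" "\<And>w. w \<in> ball 0 1 - {0} \<Longrightarrow> g w = q w"
    and h: "h holomorphic_on ball 0 1" "\<And>w. w \<in> ball 0 1 - {0} \<Longrightarrow> h w = p w"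
    using holomorphic_on_extend_bounded[OF holq] holomorphic_on_extend_bounded[OF holp]
    by (metis centre_in_ball interior_open open_ball zero_less_one)
  \<comment> \<open>Here \<open>|G| < 1\<close> suffices, because \<open>|w| ^ m\<close> tends to 1
    at the circle.\<close>
  have g1: "cmod (g w) \<le> 1" if "w \<in> ball 0 1" for w
  proof (rule norm_le_one_of_boundary[OF g(1) _ that])
    fix \<epsilon> :: real assume "\<epsilon> > 0"
    have "((\<lambda>t::real. 1 / t ^ m) \<longlongrightarrow> 1 / 1 ^ m) (at_left 1)" by (intro tendsto_intros) auto
    then have "eventually (\<lambda>t::real. 1 / t ^ m < 1 + \<epsilon>) (at_left 1)"
      using \<open>\<epsilon> > 0\<close> by (intro order_tendstoD) auto
    then obtain t where t: "t < 1" "\<And>s. t < s \<Longrightarrow> s < 1 \<Longrightarrow> 1 / s ^ m < 1 + \<epsilon>"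
      unfolding eventually_at_left_field by blast
    show "\<exists>t<1. \<forall>w. t < cmod w \<and> cmod w < 1 \<longrightarrow> cmod (g w) \<le> 1 + \<epsilon>"
    proof (intro exI[of _ "max t 0"] conjI allI impI)
      show "max t 0 < 1" using t by simp
      fix w assume w: "max t 0 < cmod w \<and> cmod w < 1"
      then have wb: "w \<in> ball 0 1 - {0}" by auto
      have "cmod (g w) = cmod (G (f (\<psi> w))) / cmod w ^ m" using g(2)[OF wb] by (simp add: q_def norm_divide norm_power)
      also have "\<dots> \<le> 1 / cmod w ^ m"
        using G1[of "f (\<psi> w)"] \<psi>A[OF wb] fA by (intro divide_right_mono) auto
      finally show "cmod (g w) \<le> 1 + \<epsilon>" using t(2)[of "cmod w"] w by auto
    qed
  qed
  \<comment> \<open>The reciprocal needs \<open>|G (f z)|\<close> to tend to 1 along with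
    \<open>|G z|\<close>, which is properness.\<close>
  have h1: "cmod (h w) \<le> 1" if "w \<in> ball 0 1" for w
  proof (rule norm_le_one_of_boundary[OF h(1) _ that])
    fix \<epsilon> :: real assume "\<epsilon> > 0"
    have cf: "continuous_on UNIV f" using holf by (rule holomorphic_on_imp_continuous_on)
    obtain t where t: "t < 1" "\<And>z. z \<in> ?A \<Longrightarrow> t < cmod (G z) \<Longrightarrow> 1 / (1 + \<epsilon>) < cmod (G (f z))"
      using biholo_to_disk_proper[OF G opA cf fA, of "1 / (1 + \<epsilon>)"] \<open>\<epsilon> > 0\<close> by auto
    show "\<exists>t<1. \<forall>w. t < cmod w \<and> cmod w < 1 \<longrightarrow> cmod (h w) \<le> 1 + \<epsilon>"
    proof (intro exI[of _ "max t 0"] conjI allI impI)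
      show "max t 0 < 1" using t by simp
      fix w assume w: "max t 0 < cmod w \<and> cmod w < 1"
      then have wb: "w \<in> ball 0 1 - {0}" by auto
      have lo: "1 / (1 + \<epsilon>) < cmod (G (f (\<psi> w)))" using t(2)[of "\<psi> w"] \<psi>A[OF wb] w by auto
      have "cmod (h w) = cmod w ^ m / cmod (G (f (\<psi> w)))" using h(2)[OF wb] by (simp add: p_def norm_divide norm_power)
      also have "\<dots> \<le> 1 / (1 / (1 + \<epsilon>))"
        using lo w \<open>\<epsilon> > 0\<close> by (intro frac_le) (auto intro!: power_le_one)
      finally show "cmod (h w) \<le> 1 + \<epsilon>" by simp
    qed
  qed
  have gh: "cmod (g w) = 1" if w: "w \<in> ball 0 1 - {0}" for w
  proof -
    have "g w * h w = 1" using g(2)[OF w] h(2)[OF w] w Gf0[OF w] by (simp add: q_def p_def)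
    then have "cmod (g w) * cmod (h w) = 1" by (metis norm_mult norm_one)
    moreover have "cmod (g w) * cmod (h w) \<le> cmod (g w) * 1" using h1[of w] w by (intro mult_left_mono) auto
    ultimately show ?thesis using g1[of w] w by simp
  qed
  have half: "(1/2::complex) \<in> ball 0 1 - {0}" by (simp add: norm_divide)
  have "g constant_on ball 0 1"
  proof (rule maximum_modulus_principle[OF g(1), of "ball 0 1" "1/2"])
    fix w :: complex assume "w \<in> ball 0 1"
    then show "cmod (g w) \<le> cmod (g (1/2))" using g1[of w] gh[OF half] by simp
  qed (auto simp: norm_divide)
  then obtain \<kappa> where \<kappa>: "\<And>w. w \<in> ball 0 1 \<Longrightarrow> g w = \<kappa>" unfolding constant_on_def by blast
  show thesis
  proof
    show "cmod \<kappa> = 1" using \<kappa>[of "1/2"] gh[OF half] half by simp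
    fix z assume z: "z \<in> ?A"
    have w: "G z \<in> ball 0 1 - {0}" using z by (rule Gb)
    then have "q (G z) = \<kappa>" using g(2)[OF w] \<kappa>[of "G z"] by simp
    then show "G (f z) = \<kappa> * G z ^ m" using G0[OF z] \<psi>(2)[OF z] by (simp add: q_def field_simps)
  qed
qed

section \<open>Integrability\<close>

text \<open>Dyadic annuli: doubling the radius multiplies the area by 4 and the integrand by
  \<open>2 powr (- 2 * p)\<close>. The ratio \<open>x\<close> of the resulting geometric series is
  below 1 exactly when \<open>p > 1\<close>.\<close>

lemma nn_integral_powr_at_infinity:
  fixes p \<rho> :: real
  assumes "p > 1" "\<rho> > 0"
  shows "(\<integral>\<^sup>+ z. ennreal (cmod (z::complex) powr (- 2 * p)) * indicator {z. cmod z \<ge> \<rho>} z \<partial>lborel) < \<infinity>"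
proof -
  define V where "V = unit_ball_vol (real DIM(complex))"
  define x where "x = 2 powr (2 - 2 * p)"
  have x: "0 < x" "x < 1"
    using assms powr_less_mono[of "2 - 2 * p" 0 2] by (auto simp: x_def)
  let ?g = "\<lambda>n z. ennreal ((2 ^ n * \<rho>) powr (- 2 * p)) * indicator (ball 0 (2 ^ Suc n * \<rho>)) (z::complex)"
  have le: "ennreal (cmod z powr (- 2 * p)) * indicator {z. cmod z \<ge> \<rho>} z \<le> (\<Sum>n. ?g n z)" for z
  proof (cases "cmod z \<ge> \<rho>")
    case True
    obtain N where N: "cmod z < 2 ^ N * \<rho>"
    proof -
      obtain N where "cmod z / \<rho> < 2 ^ N" using real_arch_pow[of 2 "cmod z / \<rho>"] by auto
      then show ?thesis using that assms by (simp add: field_simps)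
    qed
    define k where "k = (LEAST n. cmod z < 2 ^ n * \<rho>)"
    have k: "cmod z < 2 ^ k * \<rho>" unfolding k_def using N by (rule LeastI)
    then obtain n where n: "k = Suc n" using True by (cases k) auto
    have "\<not> cmod z < 2 ^ n * \<rho>" using not_less_Least[of n "\<lambda>n. cmod z < 2 ^ n * \<rho>"] n k_def by simp
    then have "cmod z powr (- 2 * p) \<le> (2 ^ n * \<rho>) powr (- 2 * p)"
      using assms by (intro powr_mono2') auto
    then have "ennreal (cmod z powr (- 2 * p)) * indicator {z. cmod z \<ge> \<rho>} z \<le> ?g n z"
      using k n True by (auto simp: ennreal_leI)
    also have "?g n z \<le> (\<Sum>n. ?g n z)"
    proof -
      have "\<phi> n \<le> suminf \<phi>" for \<phi> :: "nat \<Rightarrow> ennreal" using sum_le_suminf[of \<phi> "{n}"] by simp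
      then show ?thesis .
    qed
    finally show ?thesis .
  qed simp
  have tm: "(\<integral>\<^sup>+ z. ?g n z \<partial>lborel) = ennreal (\<rho> powr (- 2 * p) * (V * (2 * \<rho>)\<^sup>2) * x ^ n)" for n
  proof -
    have "(\<integral>\<^sup>+ z. ?g n z \<partial>lborel) = ennreal ((2 ^ n * \<rho>) powr (- 2 * p)) * emeasure lborel (ball (0::complex) (2 ^ Suc n * \<rho>))"
      by (simp add: nn_integral_cmult_indicator)
    also have "emeasure lborel (ball (0::complex) (2 ^ Suc n * \<rho>)) = ennreal (V * (2 ^ Suc n * \<rho>)\<^sup>2)"
      using assms by (subst emeasure_ball) (auto simp: V_def)
    also have "ennreal ((2 ^ n * \<rho>) powr (- 2 * p)) * \<dots> = ennreal ((2 ^ n * \<rho>) powr (- 2 * p) * (V * (2 ^ Suc n * \<rho>)\<^sup>2))"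
      by (simp add: ennreal_mult' V_def)
    also have "(2 ^ n * \<rho>) powr (- 2 * p) * (V * (2 ^ Suc n * \<rho>)\<^sup>2) = \<rho> powr (- 2 * p) * (V * (2 * \<rho>)\<^sup>2) * x ^ n"
    proof -
      have "x ^ n = 2 powr (real n * (2 - 2 * p))"
        by (simp add: x_def powr_powr mult.commute flip: powr_realpow)
      also have "\<dots> = (2 powr real n) ^ 2 * (2 powr real n) powr (- 2 * p)"
        by (simp add: powr_powr algebra_simps flip: powr_add powr_realpow)
      also have "\<dots> = (2 ^ n)\<^sup>2 * (2 ^ n) powr (- 2 * p)" by (simp add: powr_realpow)
      finally show ?thesis
        using assms by (simp add: powr_mult power_mult_distrib)
    qed
    finally show ?thesis .
  qed
  have "(\<integral>\<^sup>+ z. ennreal (cmod (z::complex) powr (- 2 * p)) * indicator {z. cmod z \<ge> \<rho>} z \<partial>lborel)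
      \<le> (\<integral>\<^sup>+ z. (\<Sum>n. ?g n z) \<partial>lborel)"
    by (intro nn_integral_mono le)
  also have "\<dots> = (\<Sum>n. \<integral>\<^sup>+ z. ?g n z \<partial>lborel)"
    by (intro nn_integral_suminf borel_measurable_times_ennreal borel_measurable_const borel_measurable_indicator) simp
  also have "\<dots> = (\<Sum>n. ennreal (\<rho> powr (- 2 * p) * (V * (2 * \<rho>)\<^sup>2) * x ^ n))"
    by (simp only: tm)
  also have "\<dots> < \<infinity>"
    using x by (subst suminf_ennreal_eq[OF _ summable_sums]) (auto simp: V_def intro!: summable_mult summable_geometric)
  finally show ?thesis .
qed

text \<open>Differentiating \<open>F z = H (1 / z)\<close> gives \<open>- H' (1 / z) / z^2\<close>,
  with \<open>H'\<close> bounded near 0.\<close>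

lemma biholo_to_disk_deriv_at_infinity:
  assumes F: "biholo_to_disk A F c" and "open A"
  obtains \<rho> C where "\<rho> > 0" "C \<ge> 0" "\<And>z. cmod z \<ge> \<rho> \<Longrightarrow> z \<in> A \<and> cmod (deriv F z) \<le> C * cmod z powr (-2)"
proof -
  have holF: "F holomorphic_on A" using F unfolding biholo_to_disk_def by auto
  define H where "H w = (if w = 0 then c else F (1 / w))" for w
  obtain r where r: "r > 0" "ball 0 r - {0} \<subseteq> (\<lambda>z. 1 / z) ` A" "H holomorphic_on ball 0 r"
    using F unfolding biholo_to_disk_def H_def by auto
  have inA: "1 / w \<in> A" if "w \<in> ball 0 r" "w \<noteq> 0" for w using r(2) that by force
  have "compact (deriv H ` cball 0 (r / 2))"
    using r by (intro compact_continuous_image continuous_on_subset[OF holomorphic_on_imp_continuous_on[OF holomorphic_deriv[OF r(3)]]]) auto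
  then obtain C where C: "\<And>w. w \<in> cball 0 (r / 2) \<Longrightarrow> cmod (deriv H w) \<le> C"
    using compact_imp_bounded bounded_iff by (metis imageI)
  have C0: "C \<ge> 0" using C[of 0] r norm_ge_zero[of "deriv H 0"] by (simp del: norm_ge_zero)
  show thesis
  proof (rule that[of "2 / r" C])
    fix z assume z: "cmod z \<ge> 2 / r"
    have z0: "z \<noteq> 0" using z r by (auto simp: divide_le_0_iff)
    have w: "cmod (1 / z) \<le> r / 2" using z z0 r by (simp add: norm_divide field_simps)
    then have wr: "1 / z \<in> ball 0 r" using r by auto
    have zA: "z \<in> A" using inA[OF wr] z0 by simp
    have "(H has_field_derivative deriv H (1 / z)) (at (1 / z))"
      using holomorphic_derivI[OF r(3) _ wr] by auto
    moreover have "((\<lambda>z. 1 / z) has_field_derivative - (1 / z\<^sup>2)) (at z)"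
      using z0 by (auto intro!: derivative_eq_intros simp: power2_eq_square)
    ultimately have "((\<lambda>z. H (1 / z)) has_field_derivative deriv H (1 / z) * - (1 / z\<^sup>2)) (at z)"
      by (rule DERIV_chain2)
    moreover have "\<forall>\<^sub>F x in nhds z. H (1 / x) = F x"
      by (rule eventually_mono[OF t1_space_nhds[OF z0]]) (simp add: H_def)
    ultimately have "deriv F z = deriv H (1 / z) * - (1 / z\<^sup>2)"
      by (metis DERIV_imp_deriv DERIV_cong_ev)
    then have "cmod (deriv F z) = cmod (deriv H (1 / z)) * (1 / (cmod z)\<^sup>2)"
      by (simp add: norm_mult norm_divide norm_power)
    also have "\<dots> \<le> C * (1 / (cmod z)\<^sup>2)" using C[of "1 / z"] w by (intro mult_right_mono) auto
    also have "1 / (cmod z)\<^sup>2 = cmod z powr (-2)"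
      using z0 by (simp add: powr_minus divide_inverse)
    finally show "z \<in> A \<and> cmod (deriv F z) \<le> C * cmod z powr (-2)" using zA by simp
  qed (use r C0 in auto)
qed

section \<open>Expansion outside a disk, critical points, and the bound for the constant
  term\<close>

text \<open>The quotient \<open>|f w| / |w|\<close> is at least
  \<open>x ^ (m-1) * (1 - m * \<delta>) - |a 0| / x\<close> with \<open>x = |w|\<close>. This is
  monotone in \<open>x\<close>, so the condition is only imposed at \<open>x = S\<close>.\<close>

lemma monic_poly_expanding:
  fixes S \<delta> :: real
  assumes m: "m \<ge> 1" and a: "\<And>k. k \<in> {1..m-1} \<Longrightarrow> cmod (a k) \<le> \<delta>" and \<delta>: "0 \<le> \<delta>" "real m * \<delta> \<le> 1"
    and S: "S \<ge> 1" "S ^ (m - 1) * (1 - real m * \<delta>) - cmod (a 0) / S \<ge> q" and w: "cmod w \<ge> S"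
  shows "cmod (monic_poly m a w) \<ge> q * cmod w"
proof -
  define x where "x = cmod w"
  have x: "x \<ge> S" "x \<ge> 1" using w S by (auto simp: x_def)
  have "cmod (monic_poly m a w - (w ^ m + a 0)) \<le> real m * \<delta> * x ^ m"
    using x a m \<delta> by (intro norm_monic_poly_remainder_le) (auto simp: x_def intro!: power_increasing)
  moreover have "cmod (w ^ m) \<le> cmod (monic_poly m a w) + cmod (a 0) + cmod (monic_poly m a w - (w ^ m + a 0))"
    using norm_triangle_ineq4[of "monic_poly m a w - a 0" "monic_poly m a w - (w ^ m + a 0)"]
      norm_triangle_ineq4[of "monic_poly m a w" "a 0"] by (simp add: algebra_simps)
  ultimately have "x ^ m - cmod (a 0) - real m * \<delta> * x ^ m \<le> cmod (monic_poly m a w)"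
    by (simp add: norm_power x_def)
  moreover have "x ^ m - cmod (a 0) - real m * \<delta> * x ^ m = x * (x ^ (m - 1) * (1 - real m * \<delta>) - cmod (a 0) / x)"
    using x m power_Suc[of x "m - 1"] by (simp add: algebra_simps)
  moreover have "q \<le> x ^ (m - 1) * (1 - real m * \<delta>) - cmod (a 0) / x"
  proof -
    have "S ^ (m - 1) * (1 - real m * \<delta>) \<le> x ^ (m - 1) * (1 - real m * \<delta>)"
      using x S \<delta> by (intro mult_right_mono power_mono) auto
    moreover have "cmod (a 0) / x \<le> cmod (a 0) / S" using x S by (intro divide_left_mono) auto
    ultimately show ?thesis using S by linarith
  qed
  then have "x * q \<le> x * (x ^ (m - 1) * (1 - real m * \<delta>) - cmod (a 0) / x)"
    using x by (intro mult_left_mono) auto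
  ultimately show ?thesis by (simp add: x_def mult.commute)
qed

text \<open>At a critical point \<open>m * z ^ (m-1)\<close> is balanced by the small terms of the
  derivative. This first excludes \<open>|z| > 1\<close>, since \<open>m * \<delta> < 1\<close>, and
  then gives the sharper bound inside the unit disk.\<close>

lemma monic_poly_critical_point:
  assumes m: "m \<ge> 2" and a: "\<And>k. k \<in> {1..m-1} \<Longrightarrow> cmod (a k) \<le> \<delta>" and \<delta>: "0 \<le> \<delta>" "real m * \<delta> < 1"
  obtains z where "deriv (monic_poly m a) z = 0" "cmod z \<le> 1" "cmod z ^ (m - 1) \<le> real m * \<delta>"
proof -
  define p where "p = monom 1 m + (\<Sum>k<m. monom (a k) k)"
  have poly_p: "poly p = monic_poly m a"
    by (simp add: p_def monic_poly_def poly_monom poly_sum fun_eq_iff)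
  have coeff_p: "coeff p i = (if i = m then 1 else if i < m then a i else 0)" for i
    by (auto simp: p_def coeff_sum sum.delta')
  have "degree p \<ge> m" by (intro le_degree) (auto simp: coeff_p)
  then have "degree (pderiv p) \<noteq> 0" using m by (simp add: degree_pderiv)
  then obtain z where z: "poly (pderiv p) z = 0"
    using fundamental_theorem_of_algebra[of "pderiv p"] by (auto simp: constant_degree)
  have "deriv (monic_poly m a) z = poly (pderiv p) z"
    using poly_DERIV[of p z] by (simp add: poly_p DERIV_imp_deriv)
  with z have dz: "deriv (monic_poly m a) z = 0" by simp
  have m0: "real m > 0" using m by simp
  have z1: "cmod z \<le> 1"
  proof (rule ccontr)
    assume "\<not> cmod z \<le> 1"
    then have "cmod (deriv (monic_poly m a) z - of_nat m * z ^ (m - 1)) \<le> real m * (real m * \<delta> * cmod z ^ (m - 1))"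
      using a m \<delta> by (intro norm_deriv_monic_poly_remainder_le) (auto intro!: power_increasing)
    then have "cmod z ^ (m - 1) \<le> real m * \<delta> * cmod z ^ (m - 1)"
      using m0 by (simp add: dz norm_mult norm_power)
    moreover have "real m * \<delta> * cmod z ^ (m - 1) < 1 * cmod z ^ (m - 1)"
      using \<delta> \<open>\<not> cmod z \<le> 1\<close> by (intro mult_strict_right_mono zero_less_power) auto
    ultimately show False by simp
  qed
  have "cmod (deriv (monic_poly m a) z - of_nat m * z ^ (m - 1)) \<le> real m * (real m * \<delta> * 1)"
    using a m \<delta> z1 by (intro norm_deriv_monic_poly_remainder_le) (auto intro!: power_le_one)
  then have "cmod z ^ (m - 1) \<le> real m * \<delta>"
    using m0 by (simp add: dz norm_mult norm_power)
  then show thesis using that dz z1 by blast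
qed

lemma constant_term_bounded_of_critical_points:
  assumes m: "m \<ge> 3" and R: "R > 1" "R ^ (m - 1) = 2.02"
    and a: "\<And>k. k \<in> {1..m-1} \<Longrightarrow> cmod (a k) \<le> \<delta>" and \<delta>: "0 \<le> \<delta>" "\<delta> \<le> 1 / (1000 * (real m)\<^sup>2)"
    and crit: "\<And>z. deriv (monic_poly m a) z = 0 \<Longrightarrow> z \<notin> basin_fin (monic_poly m a)"
  shows "cmod (a 0) \<le> R"
proof (rule ccontr)
  let ?f = "monic_poly m a"
  define d where "d = real m * \<delta>"
  define \<gamma> where "\<gamma> = cmod (a 0)"
  assume "\<not> cmod (a 0) \<le> R"
  then have \<gamma>: "\<gamma> > R" by (simp add: \<gamma>_def)
  have d: "0 \<le> d" "real m * d \<le> 1 / 1000"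
    using m \<delta> by (auto simp: d_def field_simps power2_eq_square)
  have "3 * d \<le> real m * d" using m d by (intro mult_right_mono) auto
  then have d3: "d \<le> 1 / 3000" using d by simp
  obtain z where z: "deriv ?f z = 0" "cmod z \<le> 1" "cmod z ^ (m - 1) \<le> d"
    using monic_poly_critical_point[of m a \<delta>] m a \<delta> d3 unfolding d_def by auto
  have "cmod (?f z - (z ^ m + a 0)) \<le> real m * \<delta> * 1"
    using a m \<delta> z by (intro norm_monic_poly_remainder_le) (auto intro!: power_le_one)
  moreover have "cmod (z ^ m) \<le> d"
  proof -
    have "cmod z ^ m \<le> cmod z ^ (m - 1)" using z by (intro power_decreasing) auto
    then show ?thesis using z by (simp add: norm_power)
  qed
  moreover have "cmod (a 0) \<le> cmod (?f z) + cmod (z ^ m) + cmod (?f z - (z ^ m + a 0))"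
    using norm_triangle_ineq4[of "?f z - z ^ m" "?f z - (z ^ m + a 0)"]
      norm_triangle_ineq4[of "?f z" "z ^ m"] by (simp add: algebra_simps)
  ultimately have v: "cmod (?f z) \<ge> \<gamma> - 2 * d" by (simp add: d_def \<gamma>_def)
  \<comment> \<open>A lower bound for the modulus of the critical value, as
    \<open>\<gamma> > 1\<close>. The product form lets Bernoulli control \<open>S ^ (m-1)\<close>:
    the loss \<open>2 * m * d\<close> must be small, so \<open>\<delta>\<close> has to be of order
    \<open>1 / m^2\<close>.\<close>
  define S where "S = \<gamma> * (1 - 2 * d)"
  have "1 + real (m - 1) * (- (2 * d)) \<le> (1 + - (2 * d)) ^ (m - 1)"
    using d3 by (intro Bernoulli_inequality) auto
  moreover have "real (m - 1) * (2 * d) \<le> real m * (2 * d)" using d by (intro mult_right_mono) auto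
  ultimately have B: "0.998 \<le> (1 - 2 * d) ^ (m - 1)" using d by simp
  have "2.02 * 0.998 \<le> R ^ (m - 1) * (1 - 2 * d) ^ (m - 1)" unfolding R(2) using B by (intro mult_left_mono) auto
  also have "\<dots> \<le> \<gamma> ^ (m - 1) * (1 - 2 * d) ^ (m - 1)"
    using \<gamma> R d3 by (intro mult_right_mono power_mono) auto
  also have "\<dots> = S ^ (m - 1)" by (simp add: S_def power_mult_distrib)
  finally have Sm: "2.0159 \<le> S ^ (m - 1)" by simp
  have S0: "S \<ge> 0" using \<gamma> R d3 by (auto simp: S_def)
  have S1: "S \<ge> 1"
  proof (rule ccontr)
    assume "\<not> S \<ge> 1"
    then have "S ^ (m - 1) \<le> 1" using S0 by (intro power_le_one) auto
    with Sm show False by simp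
  qed
  have "2.0159 * (1 - d) \<le> S ^ (m - 1) * (1 - d)" using Sm d3 by (intro mult_right_mono) auto
  moreover have "\<gamma> / S \<le> 1.001" using \<gamma> R d3 by (simp add: S_def field_simps)
  ultimately have grow: "1.01 \<le> S ^ (m - 1) * (1 - real m * \<delta>) - cmod (a 0) / S"
    using d3 by (simp add: d_def \<gamma>_def)
  have md: "real m * \<delta> \<le> 1" using d3 by (simp add: d_def)
  have exp: "1.01 * cmod w \<le> cmod (?f w)" if w: "S \<le> cmod w" for w
  proof (rule monic_poly_expanding)
    show "cmod (a k) \<le> \<delta>" if "k \<in> {1..m-1}" for k using that by (rule a)
  qed (use m in linarith, fact \<delta>(1), fact md, fact S1, fact grow, fact w)
  have "1 * (2 * d) \<le> \<gamma> * (2 * d)" using \<gamma> R d by (intro mult_right_mono) auto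
  then have Sv: "S \<le> cmod (?f z)" using v by (simp add: S_def algebra_simps)
  have "?f z \<in> basin_fin ?f"
    by (rule basin_fin_escape[OF _ _ exp Sv]) (use S1 in simp_all)
  then have "z \<in> basin_fin ?f" by (simp add: basin_fin_image_iff)
  with crit[OF z(1)] show False by simp
qed

section \<open>Pullback weights and summation over exit times\<close>

text \<open>This is \<open>|(f ^^ n)'| ^ 4\<close> times the indicator of \<open>(f ^^ n) -` E\<close>; splitting off the
  first factor of the chain rule makes one application of the transfer operator an index shift.\<close>

primrec pullback_weight :: "(complex \<Rightarrow> complex) \<Rightarrow> complex set \<Rightarrow> nat \<Rightarrow> complex \<Rightarrow> real" where
  "pullback_weight f E 0 z = indicator E z"
| "pullback_weight f E (Suc n) z = cmod (deriv f z) ^ 4 * pullback_weight f E n (f z)"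

lemma pullback_weight_nonneg: "pullback_weight f E n z \<ge> 0"
  by (induction n arbitrary: z) auto

lemma pullback_weight_support: "pullback_weight f E n z \<noteq> 0 \<Longrightarrow> (f ^^ n) z \<in> E"
  by (induction n arbitrary: z) (auto simp: indicator_def funpow_swap1 split: if_splits)

lemma pullback_weight_measurable:
  assumes "f \<in> borel_measurable borel" "deriv f \<in> borel_measurable borel" "E \<in> sets borel"
  shows "pullback_weight f E n \<in> borel_measurable borel"
proof (induction n)
  case 0
  then show ?case using assms(3) by (simp add: fun_eq_iff cong: measurable_cong)
next
  case (Suc n)
  note [measurable] = Suc assms
  have "(\<lambda>z. cmod (deriv f z) ^ 4 * pullback_weight f E n (f z)) \<in> borel_measurable borel"
    by measurable
  then show ?case by (simp add: cong: measurable_cong)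
qed

text \<open>Each step changes variables along \<open>f\<close>, using two of the four derivative
  factors as the Jacobian; the weight of order \<open>n\<close> depends on \<open>f y = x\<close>
  only and leaves the fibre sum. The bound \<open>tr\<close> is demanded just for points whose orbit
  meets \<open>E\<close>, because the weight vanishes elsewhere.\<close>

lemma pullback_weight_integral_le:
  fixes f :: "complex \<Rightarrow> complex" and w :: "complex \<Rightarrow> real"
  assumes hol: "f holomorphic_on UNIV" and E: "E \<in> sets borel"
    and w: "w \<in> borel_measurable borel" "\<And>x. w x \<ge> 0" and \<Lambda>: "\<Lambda> \<ge> 0"
    and tr: "\<And>x n Y. (f ^^ n) x \<in> E \<Longrightarrow> finite Y \<Longrightarrow> (\<And>y. y \<in> Y \<Longrightarrow> f y = x) \<Longrightarrow>
       (\<Sum>y\<in>Y. (cmod (deriv f y))\<^sup>2 * w y) \<le> \<Lambda> * w x"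
  shows "(\<integral>\<^sup>+ x. ennreal (w x * pullback_weight f E n x) \<partial>lborel)
     \<le> ennreal (\<Lambda> ^ n) * (\<integral>\<^sup>+ x. ennreal (w x * indicator E x) \<partial>lborel)"
proof (induction n)
  case (Suc n)
  have f_meas: "f \<in> borel_measurable borel"
    using holomorphic_on_imp_continuous_on[OF hol] by (rule borel_measurable_continuous_onI)
  have d_meas: "deriv f \<in> borel_measurable borel"
    using holomorphic_on_imp_continuous_on[OF holomorphic_deriv[OF hol open_UNIV]]
    by (rule borel_measurable_continuous_onI)
  let ?h = "pullback_weight f E n"
  note [measurable] = f_meas d_meas w(1) pullback_weight_measurable[OF f_meas d_meas E, of n]
  have "(\<integral>\<^sup>+ y. ennreal (w y * pullback_weight f E (Suc n) y) \<partial>lborel) =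
     (\<integral>\<^sup>+ y. ennreal ((cmod (deriv f y))\<^sup>2) * ennreal ((cmod (deriv f y))\<^sup>2 * w y * ?h (f y)) \<partial>lborel)"
  proof (rule nn_integral_cong)
    fix y
    have "w y * pullback_weight f E (Suc n) y = (cmod (deriv f y))\<^sup>2 * ((cmod (deriv f y))\<^sup>2 * w y * ?h (f y))"
      by (simp add: power4_eq_xxxx power2_eq_square)
    then show "ennreal (w y * pullback_weight f E (Suc n) y) =
        ennreal ((cmod (deriv f y))\<^sup>2) * ennreal ((cmod (deriv f y))\<^sup>2 * w y * ?h (f y))"
      by (simp only: ennreal_mult' zero_le_power2)
  qed
  also have "\<dots> \<le> (\<integral>\<^sup>+ x. ennreal (\<Lambda> * (w x * ?h x)) \<partial>lborel)"
  proof (rule nn_integral_fibre_sum_le[OF hol])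
    fix x Y assume Y: "finite Y" "\<And>y. y \<in> Y \<Longrightarrow> f y = x"
    have "(\<Sum>y\<in>Y. ennreal ((cmod (deriv f y))\<^sup>2 * w y * ?h (f y))) =
        (\<Sum>y\<in>Y. ennreal ((cmod (deriv f y))\<^sup>2 * w y * ?h x))"
      using Y(2) by (intro sum.cong) auto
    also have "\<dots> = ennreal (\<Sum>y\<in>Y. (cmod (deriv f y))\<^sup>2 * w y * ?h x)"
      using w(2) pullback_weight_nonneg by (intro sum_ennreal) auto
    also have "(\<Sum>y\<in>Y. (cmod (deriv f y))\<^sup>2 * w y * ?h x) = (\<Sum>y\<in>Y. (cmod (deriv f y))\<^sup>2 * w y) * ?h x"
      by (simp add: sum_distrib_right)
    also have "\<dots> \<le> \<Lambda> * w x * ?h x"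
    proof (cases "?h x = 0")
      case False
      then have "(f ^^ n) x \<in> E" by (rule pullback_weight_support)
      then have "(\<Sum>y\<in>Y. (cmod (deriv f y))\<^sup>2 * w y) \<le> \<Lambda> * w x" using Y by (rule tr)
      then show ?thesis by (rule mult_right_mono) (rule pullback_weight_nonneg)
    qed simp
    finally show "(\<Sum>y\<in>Y. ennreal ((cmod (deriv f y))\<^sup>2 * w y * ?h (f y))) \<le> ennreal (\<Lambda> * (w x * ?h x))"
      by (simp add: ennreal_leI mult.assoc)
  qed measurable
  also have "\<dots> = ennreal \<Lambda> * (\<integral>\<^sup>+ x. ennreal (w x * ?h x) \<partial>lborel)"
    using \<Lambda> by (subst nn_integral_cmult[symmetric]) (auto simp: ennreal_mult')
  also have "\<dots> \<le> ennreal \<Lambda> * (ennreal (\<Lambda> ^ n) * (\<integral>\<^sup>+ x. ennreal (w x * indicator E x) \<partial>lborel))"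
    by (intro mult_left_mono Suc) simp
  also have "\<dots> = ennreal (\<Lambda> ^ Suc n) * (\<integral>\<^sup>+ x. ennreal (w x * indicator E x) \<partial>lborel)"
    using \<Lambda> by (simp add: ennreal_mult' mult.assoc)
  finally show ?case .
qed simp

text \<open>The chain rule for the iterated functional equation. In moduli the constant
  \<open>\<kappa>\<close> drops out.\<close>

lemma boettcher_deriv_iterate:
  assumes m: "m \<ge> 1" and fA: "\<And>z. z \<in> A \<Longrightarrow> f z \<in> A"
    and G: "\<And>z. z \<in> A \<Longrightarrow> cmod (G (f z)) = cmod (G z) ^ m"
    and dG: "\<And>z. z \<in> A \<Longrightarrow> cmod (deriv G (f z)) * cmod (deriv f z) = real m * cmod (G z) ^ (m - 1) * cmod (deriv G z)"
    and z: "z \<in> A"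
  shows "cmod (G ((f ^^ n) z)) = cmod (G z) ^ (m ^ n)"
    and "(real m ^ n * cmod (G z) ^ (m ^ n - 1) * cmod (deriv G z)) ^ 4 * indicator E ((f ^^ n) z)
       = cmod (deriv G ((f ^^ n) z)) ^ 4 * pullback_weight f E n z"
proof -
  show "cmod (G ((f ^^ n) z)) = cmod (G z) ^ (m ^ n)"
    using z
  proof (induction n arbitrary: z)
    case (Suc n)
    then show ?case using fA by (simp add: funpow_swap1 G flip: power_mult)
  qed simp
  show "(real m ^ n * cmod (G z) ^ (m ^ n - 1) * cmod (deriv G z)) ^ 4 * indicator E ((f ^^ n) z)
       = cmod (deriv G ((f ^^ n) z)) ^ 4 * pullback_weight f E n z"
    using z
  proof (induction n arbitrary: z)
    case (Suc n)
    \<comment> \<open>The subtraction on naturals is harmless as \<open>m ^ n \<ge> 1\<close>; the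
      identity lets the exponents from one step and from \<open>n\<close> steps add up.\<close>
    have e: "m ^ Suc n - 1 = (m - 1) + m * (m ^ n - 1)"
    proof -
      have "m ^ n \<ge> 1" using m by simp
      then obtain j where "m ^ n = Suc j" by (metis Suc_le_D One_nat_def)
      then show ?thesis using m by (cases m) auto
    qed
    have "real m ^ Suc n * cmod (G z) ^ (m ^ Suc n - 1) * cmod (deriv G z)
        = real m ^ n * cmod (G (f z)) ^ (m ^ n - 1) * (real m * cmod (G z) ^ (m - 1) * cmod (deriv G z))"
      unfolding e using Suc.prems by (simp add: G power_add power_mult mult_ac)
    also have "\<dots> = real m ^ n * cmod (G (f z)) ^ (m ^ n - 1) * cmod (deriv G (f z)) * cmod (deriv f z)"
      using dG[OF Suc.prems] by (simp add: mult_ac)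
    finally have eq: "real m ^ Suc n * cmod (G z) ^ (m ^ Suc n - 1) * cmod (deriv G z) =
        real m ^ n * cmod (G (f z)) ^ (m ^ n - 1) * cmod (deriv G (f z)) * cmod (deriv f z)" .
    have "(real m ^ Suc n * cmod (G z) ^ (m ^ Suc n - 1) * cmod (deriv G z)) ^ 4 * indicator E ((f ^^ Suc n) z)
       = ((real m ^ n * cmod (G (f z)) ^ (m ^ n - 1) * cmod (deriv G (f z))) ^ 4 * indicator E ((f ^^ n) (f z))) * cmod (deriv f z) ^ 4"
      unfolding eq by (simp add: power_mult_distrib funpow_swap1)
    also have "\<dots> = cmod (deriv G ((f ^^ Suc n) z)) ^ 4 * pullback_weight f E (Suc n) z"
      unfolding Suc.IH[OF fA[OF Suc.prems]] by (simp add: funpow_swap1)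
    finally show ?case .
  qed simp
qed

lemma basin_deriv_fourth_power_integrable:
  fixes m :: nat and a :: "nat \<Rightarrow> complex" and R \<delta> :: real
  defines "f \<equiv> monic_poly m a"
  assumes m: "m \<ge> 3" and R: "R > 1" "R ^ (m - 1) = 2.02" "R\<^sup>2 \<le> 2.02" "(R\<^sup>2) ^ (m-1) \<le> 4.1"
    and a: "\<And>k. k \<in> {1..m-1} \<Longrightarrow> cmod (a k) \<le> \<delta>" and \<delta>: "0 \<le> \<delta>" "\<delta> \<le> 1 / (1000 * (real m)\<^sup>2)"
    and G: "biholo_to_disk (basin_fin f) G 0" and opA: "open (basin_fin f)"
  shows "\<And>z. cmod z \<ge> R \<Longrightarrow> z \<in> basin_fin f"
    and "(\<integral>\<^sup>+ z. ennreal (cmod (deriv G z) ^ 4) * indicator (basin_fin f \<inter> cball 0 R) z \<partial>lborel) < \<infinity>"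
proof -
  let ?A = "basin_fin f"
  define c where "c = a 0"
  have holG: "G holomorphic_on ?A" and injG: "inj_on G ?A" and imG: "G ` ?A = ball 0 1 - {0}"
    using G unfolding biholo_to_disk_def by auto
  have Gb: "G z \<in> ball 0 1 - {0}" if "z \<in> ?A" for z using that unfolding imG[symmetric] by auto
  have holf: "f holomorphic_on S" for S unfolding f_def by (rule holomorphic_monic_poly)
  have fA: "f z \<in> ?A \<longleftrightarrow> z \<in> ?A" for z by (rule basin_fin_image_iff)
  obtain \<kappa> where \<kappa>: "cmod \<kappa> = 1" "\<And>z. z \<in> ?A \<Longrightarrow> G (f z) = \<kappa> * G z ^ m"
    using boettcher_equation[of m a G] m G opA unfolding f_def by auto
  have deq: "deriv G (f z) * deriv f z = \<kappa> * (of_nat m * G z ^ (m - 1) * deriv G z)" if z: "z \<in> ?A" for z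
  proof -
    have dG: "(G has_field_derivative deriv G x) (at x)" if "x \<in> ?A" for x
      using holG opA that by (rule holomorphic_derivI)
    have df: "(f has_field_derivative deriv f z) (at z)"
      using holf[of UNIV] by (intro holomorphic_derivI) auto
    have 1: "((\<lambda>z. G (f z)) has_field_derivative deriv G (f z) * deriv f z) (at z)"
      by (rule DERIV_chain2[OF dG df]) (use z fA in simp)
    have 2: "((\<lambda>z. \<kappa> * G z ^ m) has_field_derivative \<kappa> * (of_nat m * G z ^ (m - 1) * deriv G z)) (at z)"
      using DERIV_cmult[OF DERIV_power[OF dG[OF z], of m], of \<kappa>] by (simp add: mult_ac)
    have "\<forall>\<^sub>F x in nhds z. G (f x) = \<kappa> * G x ^ m"
      using eventually_nhds_in_open[OF opA z] by (rule eventually_mono) (rule \<kappa>(2))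
    then have "deriv (\<lambda>z. G (f z)) z = deriv (\<lambda>z. \<kappa> * G z ^ m) z"
      by (rule deriv_cong_ev) simp
    then show ?thesis using 1 2 by (simp add: DERIV_imp_deriv)
  qed
  \<comment> \<open>The right side of the differentiated equation has no zero:
    \<open>G z \<noteq> 0\<close>, and \<open>deriv G z \<noteq> 0\<close> by injectivity.\<close>
  have crit: "z \<notin> ?A" if "deriv f z = 0" for z
  proof
    assume z: "z \<in> ?A"
    have "deriv G z \<noteq> 0" by (rule holomorphic_injective_imp_regular[OF holG opA injG z])
    then show False using deq[OF z] that Gb[OF z] m \<kappa>(1) by auto
  qed
  have cR: "cmod c \<le> R"
    unfolding c_def
    by (rule constant_term_bounded_of_critical_points[OF m R(1,2) a \<delta>]) (use crit in \<open>auto simp: f_def\<close>)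
  define d where "d = real m * \<delta>"
  have d: "0 \<le> d" "real m * d \<le> 1 / 1000"
    using m \<delta> by (auto simp: d_def field_simps power2_eq_square)
  have "3 * d \<le> real m * d" using m d by (intro mult_right_mono) auto
  then have d3: "d \<le> 1 / 3000" using d by simp
  have grow: "1.01 * cmod w \<le> cmod (f w)" if w: "R \<le> cmod w" for w
    unfolding f_def
  proof (rule monic_poly_expanding)
    show "cmod (a k) \<le> \<delta>" if "k \<in> {1..m-1}" for k using that by (rule a)
    have "cmod (a 0) / R \<le> 1" using cR R(1) by (simp add: c_def)
    moreover have "real m * \<delta> \<le> 1 / 3000" using d3 by (simp add: d_def)
    moreover have "1.01 \<le> 2.02 * (1 - s) - t" if "t \<le> 1" "s \<le> 1 / 3000" for s t :: real
      using that by (simp add: field_simps)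
    ultimately show "1.01 \<le> R ^ (m - 1) * (1 - real m * \<delta>) - cmod (a 0) / R" unfolding R(2) by blast
    show "real m * \<delta> \<le> 1" using d3 by (simp add: d_def)
  qed (use m in linarith, fact \<delta>(1), use R(1) in linarith, fact w)
  show inA: "z \<in> ?A" if "cmod z \<ge> R" for z
    by (rule basin_fin_escape[OF _ _ grow that]) (use R(1) in simp_all)
  \<comment> \<open>The exterior is forward invariant, so a point whose orbit meets \<open>E\<close>
    lies in the closed disk of radius \<open>R\<close>; by \<open>grow\<close>, so does the fibre
    over it.\<close>
  have stay: "cmod ((f ^^ n) w) > R" if "cmod w > R" for n w
  proof (induction n)
    case (Suc n)
    then have "1.01 * cmod ((f ^^ n) w) \<le> cmod ((f ^^ Suc n) w)" using grow[of "(f ^^ n) w"] by simp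
    moreover have "1 * cmod ((f ^^ n) w) \<le> 1.01 * cmod ((f ^^ n) w)" by (intro mult_right_mono) auto
    ultimately show ?case using Suc by linarith
  qed (use that in simp)
  define E where "E = {z. cmod z \<le> R \<and> R < cmod (f z)}"
  have contf: "continuous_on UNIV f" using holf by (rule holomorphic_on_imp_continuous_on)
  have f_meas [measurable]: "f \<in> borel_measurable borel" using contf by (rule borel_measurable_continuous_onI)
  have d_meas: "deriv f \<in> borel_measurable borel"
    using holomorphic_on_imp_continuous_on[OF holomorphic_deriv[OF holf open_UNIV]]
    by (rule borel_measurable_continuous_onI)
  have E_meas: "E \<in> sets borel" unfolding E_def by measurable
  define w where "w x = (cmod (x - c))\<^sup>2 + 2" for x
  have w_meas [measurable]: "w \<in> borel_measurable borel" unfolding w_def by measurable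
  have w0: "w x \<ge> 1" for x by (simp add: w_def)
  define \<Lambda> where "\<Lambda> = real m ^ 3 * (real m - 1 / 20)"
  have \<Lambda>0: "\<Lambda> \<ge> 0" using m by (simp add: \<Lambda>_def)
  let ?h = "pullback_weight f E"
  have J: "(\<integral>\<^sup>+ x. ennreal (w x * ?h n x) \<partial>lborel) \<le> ennreal (\<Lambda> ^ n) * (\<integral>\<^sup>+ x. ennreal (w x * indicator E x) \<partial>lborel)" for n
  proof (rule pullback_weight_integral_le[OF holf E_meas w_meas])
    fix x n Y assume x: "(f ^^ n) x \<in> E" and Y: "finite Y" "\<And>y. y \<in> Y \<Longrightarrow> f y = x"
    have xR: "cmod x \<le> R" using stay[of x n] x by (force simp: E_def)
    have fib: "cmod y \<le> R" if "f y = x" for y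
      using grow[of y] xR R(1) that by (cases "cmod y \<le> R") auto
    show "(\<Sum>y\<in>Y. (cmod (deriv f y))\<^sup>2 * w y) \<le> \<Lambda> * w x"
      unfolding w_def \<Lambda>_def c_def f_def
      by (rule transfer_operator_le[OF m R a \<delta>]) (use cR fib Y in \<open>auto simp: c_def f_def\<close>)
  qed (use w0 \<Lambda>0 in \<open>auto intro: order_trans[OF zero_le_one]\<close>)
  define J0 where "J0 = (\<integral>\<^sup>+ x. ennreal (w x * indicator E x) \<partial>lborel)"
  define W where "W = (R + R)\<^sup>2 + 2"
  have "J0 \<le> (\<integral>\<^sup>+ x. ennreal W * indicator (cball 0 R) (x::complex) \<partial>lborel)"
    unfolding J0_def
  proof (rule nn_integral_mono)
    fix x
    show "ennreal (w x * indicator E x) \<le> ennreal W * indicator (cball 0 R) x"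
    proof (cases "x \<in> E")
      case True
      then have xR: "cmod x \<le> R" by (simp add: E_def)
      then have "cmod (x - c) \<le> R + R" using norm_triangle_ineq4[of x c] cR by simp
      then have "w x \<le> W" unfolding w_def W_def by (intro add_mono power_mono) auto
      then show ?thesis using True xR by (simp add: ennreal_leI)
    qed simp
  qed
  also have "\<dots> = ennreal W * emeasure lborel (cball (0::complex) R)"
    by (rule nn_integral_cmult_indicator) simp
  also have "\<dots> < \<infinity>"
    unfolding infinity_ennreal_def ennreal_mult_less_top
    using emeasure_bounded_finite[of "cball (0::complex) R"] by auto
  finally obtain j0 where j0: "J0 = ennreal j0" "j0 \<ge> 0" by (cases J0) auto
  obtain b where b: "b > 0" "\<And>z. z \<in> ?A \<Longrightarrow> cmod z \<le> R \<Longrightarrow> cmod (G z) \<ge> b"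
    using biholo_to_disk_bounded_below[OF G] by blast
  \<comment> \<open>The closed version of \<open>E\<close> is compact and, since \<open>f z\<close>
    lies in the basin by \<open>inA\<close>, contained in the basin; hence a bound \<open>C\<close>
    for \<open>|G'|\<close> at all exit points.\<close>
  define K where "K = {z. cmod z \<le> R \<and> R \<le> cmod (f z)}"
  have KA: "K \<subseteq> ?A" using inA fA by (auto simp: K_def)
  have "closed K" unfolding K_def
    using contf by (intro closed_Collect_conj closed_Collect_le continuous_intros)
  moreover have "bounded K" by (rule bounded_subset[of "cball 0 R"]) (auto simp: K_def)
  ultimately have "compact K" by (simp add: compact_eq_bounded_closed)
  have contG': "continuous_on ?A (deriv G)"
    by (intro holomorphic_on_imp_continuous_on holomorphic_deriv holG opA)
  have "compact (deriv G ` K)"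
    by (intro compact_continuous_image continuous_on_subset[OF contG' KA] \<open>compact K\<close>)
  then obtain C where C: "\<And>z. z \<in> K \<Longrightarrow> cmod (deriv G z) \<le> C"
    using compact_imp_bounded bounded_iff by (metis imageI)
  have EK: "E \<subseteq> K" by (auto simp: E_def K_def)
  have Geq: "cmod (G (f z)) = cmod (G z) ^ m" if "z \<in> ?A" for z
    using \<kappa>(1) \<kappa>(2)[OF that] by (simp add: norm_mult norm_power)
  have dGeq: "cmod (deriv G (f z)) * cmod (deriv f z) = real m * cmod (G z) ^ (m - 1) * cmod (deriv G z)" if "z \<in> ?A" for z
    using \<kappa>(1) arg_cong[OF deq[OF that], of cmod] by (simp add: norm_mult norm_power)
  define B where "B = (C / b) ^ 4"
  have ptw: "cmod (deriv G z) ^ 4 \<le> B * (1 / real m ^ 4) ^ n * ?h n z" if z: "z \<in> ?A" "(f ^^ n) z \<in> E" for z n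
  proof -
    have m1: "m \<ge> 1" using m by simp
    note it = boettcher_deriv_iterate(1)[OF m1 fA[THEN iffD2] Geq dGeq z(1), of n]
      boettcher_deriv_iterate(2)[OF m1 fA[THEN iffD2] Geq dGeq z(1), of n E]
    have zn: "(f ^^ n) z \<in> ?A" using z(1) by (simp only: funpow_mem_basin_fin_iff)
    \<comment> \<open>The exit point is bounded, so \<open>|G|\<close> is at least \<open>b\<close>
      there. As \<open>|G z| < 1\<close>, the exponent \<open>m ^ n\<close> may be lowered to
      \<open>m ^ n - 1\<close>, the one in the derivative formula.\<close>
    have "b \<le> cmod (G ((f ^^ n) z))" using b(2)[OF zn] z(2) by (auto simp: E_def)
    also have "\<dots> = cmod (G z) ^ (m ^ n)" by (rule it(1))
    also have "\<dots> \<le> cmod (G z) ^ (m ^ n - 1)"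
      using Gb[OF z(1)] by (intro power_decreasing) auto
    finally have bG: "b \<le> cmod (G z) ^ (m ^ n - 1)" .
    have "(real m ^ n * b * cmod (deriv G z)) ^ 4 \<le> (real m ^ n * cmod (G z) ^ (m ^ n - 1) * cmod (deriv G z)) ^ 4"
      using bG b(1) by (intro power_mono mult_right_mono mult_left_mono) auto
    also have "\<dots> = cmod (deriv G ((f ^^ n) z)) ^ 4 * ?h n z" using it(2) z(2) by simp
    also have "\<dots> \<le> C ^ 4 * ?h n z"
      using C[of "(f ^^ n) z"] EK z(2) by (intro mult_right_mono power_mono pullback_weight_nonneg) auto
    finally have "(real m ^ 4) ^ n * b ^ 4 * cmod (deriv G z) ^ 4 \<le> C ^ 4 * ?h n z"
      by (simp only: power_mult_distrib power_mult[symmetric] mult.commute[of n 4])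
    moreover have "(real m ^ 4) ^ n * b ^ 4 > 0" using m b(1) by simp
    ultimately have "cmod (deriv G z) ^ 4 \<le> C ^ 4 * ?h n z / ((real m ^ 4) ^ n * b ^ 4)"
      by (simp only: pos_le_divide_eq mult.commute)
    also have "\<dots> = B * (1 / real m ^ 4) ^ n * ?h n z"
      by (simp add: B_def power_divide)
    finally show ?thesis .
  qed
  have exit: "\<exists>n. (f ^^ n) z \<in> E" if z: "z \<in> ?A" "cmod z \<le> R" for z
  proof -
    obtain N where N: "cmod ((f ^^ N) z) > R" using basin_fin_eventually_large[OF z(1)] by blast
    define k where "k = (LEAST n. cmod ((f ^^ n) z) > R)"
    have k: "cmod ((f ^^ k) z) > R" unfolding k_def using N by (rule LeastI)
    then obtain n where n: "k = Suc n" using z(2) by (cases k) auto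
    have "\<not> cmod ((f ^^ n) z) > R" using not_less_Least[of n "\<lambda>n. cmod ((f ^^ n) z) > R"] n k_def by simp
    then show ?thesis using k n by (intro exI[of _ n]) (auto simp: E_def)
  qed
  \<comment> \<open>The ratio of the final geometric series, equal to
    \<open>1 - 1 / (20 * m)\<close>.\<close>
  define q where "q = \<Lambda> / real m ^ 4"
  have q: "0 \<le> q" "q < 1"
    using m by (auto simp: q_def \<Lambda>_def power3_eq_cube power4_eq_xxxx)
  have h_meas [measurable]: "?h n \<in> borel_measurable borel" for n
    by (rule pullback_weight_measurable[OF f_meas d_meas E_meas])
  have B0: "B \<ge> 0" by (simp add: B_def)
  \<comment> \<open>At each \<open>z\<close> the term of an exit time alone dominates the integrand;
    the factor \<open>w z \<ge> 1\<close> is inserted at no cost.\<close>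
  have "(\<integral>\<^sup>+ z. ennreal (cmod (deriv G z) ^ 4) * indicator (?A \<inter> cball 0 R) z \<partial>lborel)
      \<le> (\<integral>\<^sup>+ z. (\<Sum>n. ennreal (B * (1 / real m ^ 4) ^ n * (w z * ?h n z))) \<partial>lborel)"
  proof (rule nn_integral_mono)
    fix z
    show "ennreal (cmod (deriv G z) ^ 4) * indicator (?A \<inter> cball 0 R) z
      \<le> (\<Sum>n. ennreal (B * (1 / real m ^ 4) ^ n * (w z * ?h n z)))"
    proof (cases "z \<in> ?A \<inter> cball 0 R")
      case True
      then obtain n where n: "(f ^^ n) z \<in> E" using exit[of z] by auto
      have "1 * ?h n z \<le> w z * ?h n z" by (intro mult_right_mono w0 pullback_weight_nonneg)
      then have "B * (1 / real m ^ 4) ^ n * ?h n z \<le> B * (1 / real m ^ 4) ^ n * (w z * ?h n z)"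
        using B0 by (intro mult_left_mono) auto
      then have "cmod (deriv G z) ^ 4 \<le> B * (1 / real m ^ 4) ^ n * (w z * ?h n z)"
        using ptw[of z n] True n by auto
      then have "ennreal (cmod (deriv G z) ^ 4) \<le> ennreal (B * (1 / real m ^ 4) ^ n * (w z * ?h n z))"
        by (rule ennreal_leI)
      also have "\<dots> \<le> (\<Sum>n. ennreal (B * (1 / real m ^ 4) ^ n * (w z * ?h n z)))"
      proof -
        have "\<phi> n \<le> suminf \<phi>" for \<phi> :: "nat \<Rightarrow> ennreal" using sum_le_suminf[of \<phi> "{n}"] by simp
        then show ?thesis .
      qed
      finally show ?thesis using True by simp
    qed simp
  qed
  also have "\<dots> = (\<Sum>n. \<integral>\<^sup>+ z. ennreal (B * (1 / real m ^ 4) ^ n * (w z * ?h n z)) \<partial>lborel)"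
    by (rule nn_integral_suminf) measurable
  also have "\<dots> = (\<Sum>n. ennreal (B * (1 / real m ^ 4) ^ n) * (\<integral>\<^sup>+ z. ennreal (w z * ?h n z) \<partial>lborel))"
  proof (rule suminf_cong)
    fix n
    have "(\<integral>\<^sup>+ z. ennreal (B * (1 / real m ^ 4) ^ n * (w z * ?h n z)) \<partial>lborel) =
       (\<integral>\<^sup>+ z. ennreal (B * (1 / real m ^ 4) ^ n) * ennreal (w z * ?h n z) \<partial>lborel)"
      using B0 by (intro nn_integral_cong ennreal_mult') auto
    then show "(\<integral>\<^sup>+ z. ennreal (B * (1 / real m ^ 4) ^ n * (w z * ?h n z)) \<partial>lborel) =
       ennreal (B * (1 / real m ^ 4) ^ n) * (\<integral>\<^sup>+ z. ennreal (w z * ?h n z) \<partial>lborel)"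
      by (simp add: nn_integral_cmult)
  qed
  also have "\<dots> \<le> (\<Sum>n. ennreal (B * j0 * q ^ n))"
  proof (intro suminf_le)
    fix n
    have "ennreal (B * (1 / real m ^ 4) ^ n) * (\<integral>\<^sup>+ z. ennreal (w z * ?h n z) \<partial>lborel)
       \<le> ennreal (B * (1 / real m ^ 4) ^ n) * (ennreal (\<Lambda> ^ n) * ennreal j0)"
      using J[of n] j0 by (intro mult_left_mono) (auto simp: J0_def)
    also have "\<dots> = ennreal (B * (1 / real m ^ 4) ^ n * (\<Lambda> ^ n * j0))"
      using B0 \<Lambda>0 j0(2) by (simp add: ennreal_mult')
    also have "B * (1 / real m ^ 4) ^ n * (\<Lambda> ^ n * j0) = B * j0 * q ^ n"
      by (simp add: q_def power_divide)
    finally show "ennreal (B * (1 / real m ^ 4) ^ n) * (\<integral>\<^sup>+ z. ennreal (w z * ?h n z) \<partial>lborel) \<le> ennreal (B * j0 * q ^ n)" .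
  qed auto
  also have "\<dots> < \<infinity>"
    using q B0 j0(2) by (subst suminf_ennreal_eq[OF _ summable_sums]) (auto intro!: summable_mult summable_geometric)
  finally show "(\<integral>\<^sup>+ z. ennreal (cmod (deriv G z) ^ 4) * indicator (?A \<inter> cball 0 R) z \<partial>lborel) < \<infinity>" .
qed

theorem mainTheorem2:
  fixes m :: nat
  assumes "m \<ge> 3"
  shows "\<exists>\<delta>>0. \<forall>a :: nat \<Rightarrow> complex.
           (\<forall>k\<in>{1..m-1}. cmod (a k) < \<delta>) \<and>
           simply_connected (basin_sphere (monic_poly m a))
           \<longrightarrow> brennan_holds (basin_fin (monic_poly m a))"
proof (intro exI[of _ "1 / (1000 * (real m)\<^sup>2)"] conjI allI impI)
  \<comment> \<open>With \<open>d = m * \<delta>\<close> measuring the remainder terms, both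
    \<open>transfer_margin\<close> and the bound for \<open>a 0\<close> need \<open>m * d\<close>
    small; here it is at most 1/1000.\<close>
  let ?\<delta> = "1 / (1000 * (real m)\<^sup>2)"
  show "?\<delta> > 0" using assms by simp
  fix a :: "nat \<Rightarrow> complex"
  assume asm: "(\<forall>k\<in>{1..m-1}. cmod (a k) < ?\<delta>) \<and> simply_connected (basin_sphere (monic_poly m a))"
  then have a: "cmod (a k) \<le> ?\<delta>" if "k \<in> {1..m-1}" for k using that by (auto intro: less_imp_le)
  define f where "f = monic_poly m a"
  let ?A = "basin_fin f"
  obtain R :: real where R: "R > 1" "R ^ (m - 1) = 2.02" "R\<^sup>2 \<le> 2.02" "(R\<^sup>2) ^ (m-1) \<le> 4.1"
    using escape_radius[OF assms] by metis
  have contf: "continuous_on UNIV f"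
    unfolding f_def by (intro holomorphic_on_imp_continuous_on holomorphic_monic_poly)
  have m2: "m \<ge> 2" using assms by simp
  obtain L where L: "L \<ge> 1" "\<And>z. cmod z \<ge> L \<Longrightarrow> 2 * cmod z \<le> cmod (f z)"
    using monic_poly_large[OF m2, of a] unfolding f_def by metis
  have opA: "open ?A"
  proof (rule open_basin_fin[OF contf, of L])
    fix z assume "cmod z > L"
    then show "z \<in> ?A" by (intro basin_fin_escape[OF _ _ L(2)]) (use L(1) in auto)
  qed
  show "brennan_holds (basin_fin (monic_poly m a))"
    unfolding brennan_holds_def f_def[symmetric]
  proof (intro allI impI)
    fix F c and p :: real
    assume F: "biholo_to_disk ?A F c" and p: "4 / 3 < p \<and> p < 4"
    define G where "G z = Moebius_function 0 c (F z)" for z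
    have G: "biholo_to_disk ?A G 0"
      using biholo_to_disk_normalize(1)[OF F opA] unfolding G_def .
    define C where "C = 4 / (1 - (cmod c)\<^sup>2)"
    have FG: "cmod (deriv F z) \<le> C * cmod (deriv G z)" if "z \<in> ?A" for z
      using biholo_to_disk_normalize(2)[OF F opA that] unfolding G_def C_def .
    have holF: "F holomorphic_on ?A" and holG: "G holomorphic_on ?A"
      using F G unfolding biholo_to_disk_def by auto
    have outer: "z \<in> ?A" if "cmod z \<ge> R" for z
      using basin_deriv_fourth_power_integrable(1)[OF assms R a _ _ G[unfolded f_def] opA[unfolded f_def] that]
      by (simp add: f_def)
    define I where "I = (\<integral>\<^sup>+ z. ennreal (cmod (deriv G z) ^ 4) * indicator (?A \<inter> cball 0 R) z \<partial>lborel)"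
    have I: "I < \<infinity>"
      unfolding I_def
      using basin_deriv_fourth_power_integrable(2)[OF assms R a _ _ G[unfolded f_def] opA[unfolded f_def]]
      by (simp add: f_def)
    obtain \<rho> D where D: "\<rho> > 0" "D \<ge> 0" "\<And>z. cmod z \<ge> \<rho> \<Longrightarrow> z \<in> ?A \<and> cmod (deriv F z) \<le> D * cmod z powr (-2)"
      using biholo_to_disk_deriv_at_infinity[OF F opA] by metis
    define K where "K = cball (0::complex) \<rho> - ball 0 R"
    have "compact K" unfolding K_def by (intro compact_diff) auto
    have KA: "K \<subseteq> ?A" using outer by (auto simp: K_def)
    have contF': "continuous_on ?A (deriv F)"
      by (intro holomorphic_on_imp_continuous_on holomorphic_deriv holF opA)
    have "compact (deriv F ` K)"
      by (intro compact_continuous_image continuous_on_subset[OF contF' KA] \<open>compact K\<close>)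
    then obtain T0 where T0: "\<And>z. z \<in> K \<Longrightarrow> cmod (deriv F z) \<le> T0"
      using compact_imp_bounded bounded_iff by (metis imageI)
    \<comment> \<open>The value is raised to at least 1 so that \<open>T powr p \<le> T ^ 4\<close>
      and so that \<open>T ^ 4\<close> absorbs the 1 in \<open>t powr p \<le> t ^ 4 + 1\<close> on
      the near part.\<close>
    define T where "T = max T0 1"
    have T: "T \<ge> 1" "\<And>z. z \<in> K \<Longrightarrow> cmod (deriv F z) \<le> T"
      unfolding T_def using T0 by (simp, meson max.coboundedI1)
    let ?far = "\<lambda>z::complex. ennreal (cmod z powr (- 2 * p)) * indicator {z. cmod z \<ge> \<rho>} z"
    let ?mid = "\<lambda>z::complex. indicator (cball 0 (max \<rho> R)) z :: ennreal"
    let ?near = "\<lambda>z. ennreal (cmod (deriv G z) ^ 4) * indicator (?A \<inter> cball 0 R) z"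
    have ptw: "ennreal (cmod (deriv F z) powr p) * indicator ?A z
       \<le> ennreal (C ^ 4) * ?near z + (ennreal (T ^ 4) * ?mid z + ennreal (D powr p) * ?far z)" for z
    proof (cases "z \<in> ?A")
      case True
      have pow4: "t powr p \<le> t ^ 4" if "t \<ge> 1" for t :: real
        using powr_mono[of p 4 t] p that by simp
      consider "cmod z \<le> R" | "cmod z > R" "cmod z < \<rho>" | "cmod z \<ge> \<rho>" by linarith
      then show ?thesis
      proof cases
        case 1
        have "cmod (deriv F z) powr p \<le> cmod (deriv F z) ^ 4 + 1"
        proof (cases "cmod (deriv F z) \<ge> 1")
          case False
          then have "cmod (deriv F z) powr p \<le> 1" using p by (intro powr_le1) auto
          then show ?thesis by (smt (verit) zero_le_power norm_ge_zero)
        qed (use pow4[of "cmod (deriv F z)"] in auto)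
        also have "cmod (deriv F z) ^ 4 \<le> (C * cmod (deriv G z)) ^ 4" using FG[OF True] by (intro power_mono) auto
        finally have "cmod (deriv F z) powr p \<le> C ^ 4 * cmod (deriv G z) ^ 4 + T ^ 4"
          using one_le_power[OF T(1), of 4] by (simp add: power_mult_distrib)
        then have "ennreal (cmod (deriv F z) powr p) \<le> ennreal (C ^ 4 * cmod (deriv G z) ^ 4 + T ^ 4)"
          by (rule ennreal_leI)
        also have "\<dots> = ennreal (C ^ 4) * ?near z + ennreal (T ^ 4) * ?mid z"
          using 1 True by (simp add: ennreal_plus ennreal_mult' le_max_iff_disj)
        also have "\<dots> \<le> ennreal (C ^ 4) * ?near z + (ennreal (T ^ 4) * ?mid z + ennreal (D powr p) * ?far z)"
          by (intro add_left_mono) simp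
        finally show ?thesis using True by simp
      next
        case 2
        then have "z \<in> K" by (simp add: K_def)
        have "cmod (deriv F z) powr p \<le> T powr p" using T(2)[OF \<open>z \<in> K\<close>] p by (intro powr_mono2) auto
        also have "\<dots> \<le> T ^ 4" using pow4[OF T(1)] .
        finally have "ennreal (cmod (deriv F z) powr p) * indicator ?A z \<le> ennreal (T ^ 4) * ?mid z"
          using 2 True by (simp add: ennreal_leI le_max_iff_disj)
        also have "\<dots> \<le> ennreal (C ^ 4) * ?near z + (ennreal (T ^ 4) * ?mid z + ennreal (D powr p) * ?far z)"
          by (intro add_increasing add_increasing2 order_refl) simp_all
        finally show ?thesis .
      next
        case 3
        then have z0: "cmod z > 0" using D(1) by linarith
        have "cmod (deriv F z) powr p \<le> (D * cmod z powr (-2)) powr p"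
          using D(3)[OF 3] p by (intro powr_mono2) auto
        also have "\<dots> = D powr p * cmod z powr (- 2 * p)"
          using D(2) by (simp add: powr_mult powr_powr)
        finally have "ennreal (cmod (deriv F z) powr p) \<le> ennreal (D powr p * cmod z powr (- 2 * p))"
          by (rule ennreal_leI)
        then have "ennreal (cmod (deriv F z) powr p) * indicator ?A z \<le> ennreal (D powr p) * ?far z"
          using 3 True by (simp add: ennreal_mult')
        also have "\<dots> \<le> ennreal (C ^ 4) * ?near z + (ennreal (T ^ 4) * ?mid z + ennreal (D powr p) * ?far z)"
          by (intro add_increasing order_refl) simp_all
        finally show ?thesis .
      qed
    qed simp
    have A_meas: "?A \<inter> cball 0 R \<in> sets borel" using opA by auto
    have near_meas: "?near \<in> borel_measurable lborel"
    proof -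
      have "continuous_on ?A (\<lambda>z. cmod (deriv G z) ^ 4)"
        by (intro continuous_intros holomorphic_on_imp_continuous_on holomorphic_deriv holG opA)
      then have "(\<lambda>z. indicator (?A \<inter> cball 0 R) z *\<^sub>R cmod (deriv G z) ^ 4) \<in> borel_measurable borel"
        by (intro borel_measurable_continuous_on_indicator A_meas) (rule continuous_on_subset, auto)
      then have "(\<lambda>z. ennreal (indicator (?A \<inter> cball 0 R) z *\<^sub>R cmod (deriv G z) ^ 4)) \<in> borel_measurable borel"
        by simp
      moreover have "(\<lambda>z. ennreal (indicator (?A \<inter> cball 0 R) z *\<^sub>R cmod (deriv G z) ^ 4)) = ?near"
        by (auto simp: fun_eq_iff indicator_def)
      ultimately have "?near \<in> borel_measurable borel" by (simp only:)
      then show ?thesis by simp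
    qed
    have far_meas: "?far \<in> borel_measurable lborel" by measurable
    have mid_meas: "?mid \<in> borel_measurable lborel" by (intro borel_measurable_indicator) simp
    have "(\<integral>\<^sup>+ z\<in>?A. ennreal (cmod (deriv F z) powr p) \<partial>lborel)
       \<le> (\<integral>\<^sup>+ z. ennreal (C ^ 4) * ?near z + (ennreal (T ^ 4) * ?mid z + ennreal (D powr p) * ?far z) \<partial>lborel)"
      by (intro nn_integral_mono ptw)
    also have "\<dots> = ennreal (C ^ 4) * I + (ennreal (T ^ 4) * emeasure lborel (cball (0::complex) (max \<rho> R))
         + ennreal (D powr p) * (\<integral>\<^sup>+ z. ?far z \<partial>lborel))"
      using near_meas far_meas mid_meas by (simp add: nn_integral_add nn_integral_cmult I_def)
    \<comment> \<open>The far part needs \<open>p > 1\<close>, which \<open>4/3 < p\<close>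
      provides.\<close>
    also have "\<dots> < \<infinity>"
      using I emeasure_bounded_finite[of "cball (0::complex) (max \<rho> R)"]
        nn_integral_powr_at_infinity[of p \<rho>] p D(1)
      by (auto simp: ennreal_mult_eq_top_iff less_top[symmetric])
    finally show "(\<integral>\<^sup>+ z\<in>?A. ennreal (cmod (deriv F z) powr p) \<partial>lborel) < \<infinity>" .
  qed
qed

end
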